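(* Let $H_1,H_2$ be Hilbert spaces (both real or both complex), let $\mathbf{H}=H_1\otimes H_2$ be their Hilbert space tensor product, and let $\mathbf{u}\in\mathbf{H}$. Let $0<q<1$, $c>0$ and $R>1$ be constants, let $\Phi$ be a map on $\mathbf{H}$, and let $\mathcal{D}\subseteq\mathbf{H}$ be a set such that for every $\mathbf{u}_0\in\mathcal{D}$ the sequence $(\mathbf{u}_n)$ generated from $\mathbf{u}_0$ by $\mathbf{u}_{n+1}=\Phi(\mathbf{u}_n)$ satisfies, for all $n\ge 0$, $$\|\mathbf{u}_{n+1}-\mathbf{u}\|_{\mathbf{H}}\le c\,q^{n+1}\,\|\mathbf{u}_0-\mathbf{u}\|_{\mathbf{H}}\qquad\text{and}\qquad \operatorname{rank}(\mathbf{u}_{n+1})\le R\cdot\operatorname{rank}(\mathbf{u}_n).$$ Assume that $\mathcal{D}$ contains at least one element of rank at most one. Define $$\pi_1(\mathbf{u})=\inf\{\|\mathbf{v}-\mathbf{u}\|_{\mathbf{H}} : \mathbf{v}\in\mathcal{D},\ \operatorname{rank}(\mathbf{v})\le 1\}.$$ Then for every integer $r\ge 1$, $$\tau_r(\mathbf{u})\le c\,\pi_1(\mathbf{u})\,\sqrt{1-\frac{(1-q^2)\,(r-R^{\lfloor\log_R r\rfloor})}{(R-1)\,R^{\lfloor\log_R r\rfloor}}}\;\,q^{\lfloor\log_R r\rfloor}.$$ Simplified bounds are given by $$\tau_r(\mathbf{u})\le c\,\pi_1(\mathbf{u})\,q^{\lfloor\log_R r\rfloor}\le c\,\pi_1(\mathbf{u})\,q^{(\log_R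 r)-1}=c\,\pi_1(\mathbf{u})\,q^{-1}\left(\frac1r\right)^{\left|\frac{\ln q}{\ln R}\right|}.$$
   Context: Every $\mathbf{v}\in\mathbf{H}=H_1\otimes H_2$ has a singular value decomposition $\mathbf{v}=\sum_{k\ge1}\sigma_k\,u_k\otimes v_k$ with orthonormal systems $(u_k)$ in $H_1$ and $(v_k)$ in $H_2$ and singular values $\sigma_1\ge\sigma_2\ge\dots\ge0$ (equivalently, the SVD of the associated Hilbert–Schmidt operator between $H_1$ and $H_2$). The rank of $\mathbf{v}$ is the smallest $r$ with $\sigma_{r+1}=0$ (and $\infty$ if there is no such $r$). The best rank-$r$ approximation error is $$\tau_r(\mathbf{u})=\min_{\operatorname{rank}(\mathbf{v})\le r}\|\mathbf{u}-\mathbf{v}\|_{\mathbf{H}}=\Big(\sum_{k\ge r+1}\sigma_k^2\Big)^{1/2},$$ where $\sigma_k$ are the singular values of $\mathbf{u}$.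
   Formalization: The upper bounds on τ_r(u) are proved when c ≥ 1 or r ≥ ⌊R⌋; for c < 1 and r < ⌊R⌋ they can fail (e.g. u = 2e₁⊗e₁+e₂⊗e₂, D = {2e₁⊗e₁}, Φ ≡ u, q = c = 1/2, R = 2, r = 1). The other relations in the chain hold for all r ≥ 1. *)

theory Defs
  imports "HOL-Analysis.Analysis"
begin

section \<open>Real and complex scalars\<close>

text \<open>
  A common class for the scalar fields of real and of complex Hilbert spaces. The lemma
  \<open>rc_field_real_or_complex\<close> below shows that a type of this class is a copy of the reals or
  of the complex numbers; since \<open>z * conj z = \<bar>z\<bar>\<^sup>2\<close>, norm and conjugation are then the usual ones.
\<close>

class rc_field = real_normed_field +
  fixes conj :: "'a \<Rightarrow> 'a"
  assumes conj_add: "conj (x + y) = conj x + conj y"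
    and conj_mult: "conj (x * y) = conj x * conj y"
    and mult_conj_scaleR: "x * conj x = (norm x)\<^sup>2 *\<^sub>R 1"

instantiation real :: rc_field
begin
definition conj_real :: "real \<Rightarrow> real" where "conj_real x = x"
instance by standard (simp_all add: conj_real_def power2_eq_square)
end

instantiation complex :: rc_field
begin
definition conj_complex :: "complex \<Rightarrow> complex" where "conj_complex z = cnj z"
instance by standard (simp_all add: conj_complex_def scaleR_conv_of_real complex_norm_square[symmetric] del: of_real_power)
end

lemma mult_conj: "x * conj x = of_real ((norm (x::'k::rc_field))\<^sup>2)"
  by (simp only: mult_conj_scaleR of_real_def)

lemma conj_of_real: "conj (of_real t :: 'k::rc_field) = of_real t"
proof (cases "t = 0")
  case True
  have "conj (0::'k) + conj 0 = conj 0"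
    using conj_add[of "0::'k" 0] by simp
  then show ?thesis using True by simp
next
  case False
  have "of_real t * conj (of_real t :: 'k) = of_real t * of_real t"
    using mult_conj[of "of_real t :: 'k"] by (simp add: power2_eq_square)
  then show ?thesis using False by simp
qed

lemma conj_minus: "conj (- x :: 'k::rc_field) = - conj x"
  using conj_mult[of "-1" x] conj_of_real[of "-1", where 'k = 'k] by simp

lemma add_conj_Reals: "x + conj (x :: 'k::rc_field) \<in> \<real>"
proof -
  have "(x + 1) * conj (x + 1) = x * conj x + (x + conj x) + 1"
    using conj_of_real[of 1, where 'k = 'k] by (simp add: conj_add algebra_simps)
  then have "x + conj x = of_real ((norm (x + 1))\<^sup>2 - (norm x)\<^sup>2 - 1)"
    by (simp add: mult_conj algebra_simps)
  then show ?thesis by (metis Reals_of_real)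
qed

lemma conj_fixed_Reals: "conj x = x \<Longrightarrow> (x :: 'k::rc_field) \<in> \<real>"
proof -
  assume "conj x = x"
  then have "x = of_real (1/2) * (x + conj x)" by simp
  then show "x \<in> \<real>" using add_conj_Reals[of x] by (metis Reals_mult Reals_of_real)
qed

lemma real_plus_antifixed:
  fixes z :: "'k::rc_field"
  shows "\<exists>t y. z = of_real t + y \<and> conj y = - y"
proof -
  obtain s where s: "z + conj z = of_real s"
    using add_conj_Reals[of z] by (auto elim: Reals_cases)
  have cz: "conj z = of_real s - z" using s by (simp add: algebra_simps)
  have "conj (z + - of_real (s/2)) = of_real s - z - of_real (s/2)"
    by (simp only: conj_add conj_minus conj_of_real cz) simp
  also have "of_real s = of_real (s/2) + (of_real (s/2) :: 'k)"
    by (metis field_sum_of_halves of_real_add)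
  finally have "conj (z + - of_real (s/2)) = - (z + - of_real (s/2))" by simp
  moreover have "z = of_real (s/2) + (z + - of_real (s/2))" by simp
  ultimately show ?thesis by blast
qed

lemma rc_field_real_or_complex:
  "(\<forall>z::'k::rc_field. z \<in> \<real>) \<or>
   (\<exists>i::'k. i * i = - 1 \<and> (\<forall>z. \<exists>a b. z = of_real a + of_real b * i))"
proof (cases "\<forall>z::'k. z \<in> \<real>")
  case False
  then obtain w :: 'k where "w \<notin> \<real>" by blast
  moreover obtain t y where y: "w = of_real t + y" "conj y = - y"
    using real_plus_antifixed by blast
  ultimately have "y \<noteq> 0" by auto
  define i where "i = of_real (1 / norm y) * y"
  have ci: "conj i = - i" unfolding i_def by (simp only: conj_mult conj_of_real y) simp
  have "norm i = 1" using \<open>y \<noteq> 0\<close> by (simp add: i_def norm_mult norm_divide)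
  then have ii: "i * i = - 1" using mult_conj[of i] ci by (simp add: minus_equation_iff)
  have "\<exists>a b. z = of_real a + of_real b * i" for z
  proof -
    obtain a v where v: "z = of_real a + v" "conj v = - v"
      using real_plus_antifixed by blast
    have "v * i \<in> \<real>" by (rule conj_fixed_Reals) (simp add: conj_mult v ci)
    then obtain b where "v * i = of_real b" by (auto elim: Reals_cases)
    then have "v = of_real (- b) * i" using ii
      by (metis mult.assoc mult.commute mult_1 mult_minus_left minus_minus of_real_minus)
    then show ?thesis using v by blast
  qed
  then show ?thesis using ii by blast
qed simp


section \<open>Hilbert spaces and their tensor product\<close>

text \<open>
  Completeness and the metric come from the class \<open>banach\<close>; the inner product is linear in its
  first argument and induces the norm.
\<close>

locale hilbert_space = vector_space scale
  for scale :: "'k::rc_field \<Rightarrow> 'h::banach \<Rightarrow> 'h" +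
  fixes ip :: "'h \<Rightarrow> 'h \<Rightarrow> 'k"
  assumes scale_of_real: "scale (of_real t) x = t *\<^sub>R x"
    and ip_add: "ip (x + y) z = ip x z + ip y z"
    and ip_scale: "ip (scale a x) z = a * ip x z"
    and ip_commute: "ip y x = conj (ip x y)"
    and ip_self: "ip x x = of_real ((norm x)\<^sup>2)"

text \<open>
  The Hilbert space tensor product is the completion of the algebraic tensor product under the
  inner product determined by \<open>ip_tensor\<close>. Up to a unique isometric isomorphism compatible with
  the elementary tensors it is the only Hilbert space with the following properties.
\<close>

locale hilbert_tensor_product =
  H1: hilbert_space scale1 ip1 + H2: hilbert_space scale2 ip2 + H: hilbert_space scale ip
  for scale1 :: "'k::rc_field \<Rightarrow> 'a::banach \<Rightarrow> 'a" and ip1 :: "'a \<Rightarrow> 'a \<Rightarrow> 'k"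
    and scale2 :: "'k \<Rightarrow> 'b::banach \<Rightarrow> 'b" and ip2 :: "'b \<Rightarrow> 'b \<Rightarrow> 'k"
    and scale :: "'k \<Rightarrow> 'c::banach \<Rightarrow> 'c" and ip :: "'c \<Rightarrow> 'c \<Rightarrow> 'k" +
  fixes tensor :: "'a \<Rightarrow> 'b \<Rightarrow> 'c"
  assumes tensor_add_left: "tensor (x + x') y = tensor x y + tensor x' y"
    and tensor_add_right: "tensor x (y + y') = tensor x y + tensor x y'"
    and tensor_scale_left: "tensor (scale1 a x) y = scale a (tensor x y)"
    and tensor_scale_right: "tensor x (scale2 a y) = scale a (tensor x y)"
    and ip_tensor: "ip (tensor x y) (tensor x' y') = ip1 x x' * ip2 y y'"
    and tensor_dense: "closure (H.span {tensor x y |x y. True}) = UNIV"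


section \<open>Singular values, rank and best approximation\<close>

definition orthonormal_on :: "('h \<Rightarrow> 'h \<Rightarrow> 'k::rc_field) \<Rightarrow> nat set \<Rightarrow> (nat \<Rightarrow> 'h) \<Rightarrow> bool" where
  "orthonormal_on ip K e \<longleftrightarrow> (\<forall>j\<in>K. \<forall>k\<in>K. ip (e j) (e k) = (if j = k then 1 else 0))"

text \<open>
  Indices start at 0, so \<open>\<sigma> k\<close> is the singular value usually written \<open>\<sigma>\<^bsub>k+1\<^esub>\<close>. The singular
  vectors are only constrained where \<open>\<sigma> k > 0\<close>: in finite dimension there are no infinite
  orthonormal systems, and the remaining terms of the series vanish.
\<close>

definition is_svd ::
  "('a \<Rightarrow> 'a \<Rightarrow> 'k::rc_field) \<Rightarrow> ('b \<Rightarrow> 'b \<Rightarrow> 'k) \<Rightarrow> ('a \<Rightarrow> 'b \<Rightarrow> 'c::banach) \<Rightarrow>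
    'c \<Rightarrow> (nat \<Rightarrow> real) \<Rightarrow> (nat \<Rightarrow> 'a) \<Rightarrow> (nat \<Rightarrow> 'b) \<Rightarrow> bool" where
  "is_svd ip1 ip2 tensor v \<sigma> e f \<longleftrightarrow>
     decseq \<sigma> \<and> (\<forall>k. 0 \<le> \<sigma> k) \<and>
     orthonormal_on ip1 {k. 0 < \<sigma> k} e \<and> orthonormal_on ip2 {k. 0 < \<sigma> k} f \<and>
     (\<lambda>k. \<sigma> k *\<^sub>R tensor (e k) (f k)) sums v"

definition singular_values ::
  "('a \<Rightarrow> 'a \<Rightarrow> 'k::rc_field) \<Rightarrow> ('b \<Rightarrow> 'b \<Rightarrow> 'k) \<Rightarrow> ('a \<Rightarrow> 'b \<Rightarrow> 'c::banach) \<Rightarrow>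
    'c \<Rightarrow> nat \<Rightarrow> real" where
  "singular_values ip1 ip2 tensor v = (THE \<sigma>. \<exists>e f. is_svd ip1 ip2 tensor v \<sigma> e f)"

text \<open>The infimum of the empty set in \<^typ>\<open>enat\<close> is \<open>\<infinity>\<close>.\<close>

definition tensor_rank ::
  "('a \<Rightarrow> 'a \<Rightarrow> 'k::rc_field) \<Rightarrow> ('b \<Rightarrow> 'b \<Rightarrow> 'k) \<Rightarrow> ('a \<Rightarrow> 'b \<Rightarrow> 'c::banach) \<Rightarrow> 'c \<Rightarrow> enat" where
  "tensor_rank ip1 ip2 tensor v = Inf {enat r |r. singular_values ip1 ip2 tensor v r = 0}"

definition best_approx_error ::
  "('a \<Rightarrow> 'a \<Rightarrow> 'k::rc_field) \<Rightarrow> ('b \<Rightarrow> 'b \<Rightarrow> 'k) \<Rightarrow> ('a \<Rightarrow> 'b \<Rightarrow> 'c::banach) \<Rightarrow>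
    nat \<Rightarrow> 'c \<Rightarrow> real" where
  "best_approx_error ip1 ip2 tensor r u =
     Inf {norm (u - v) |v. tensor_rank ip1 ip2 tensor v \<le> enat r}"

definition initial_error ::
  "('a \<Rightarrow> 'a \<Rightarrow> 'k::rc_field) \<Rightarrow> ('b \<Rightarrow> 'b \<Rightarrow> 'k) \<Rightarrow> ('a \<Rightarrow> 'b \<Rightarrow> 'c::banach) \<Rightarrow>
    'c set \<Rightarrow> 'c \<Rightarrow> real" where
  "initial_error ip1 ip2 tensor D u =
     Inf {norm (v - u) |v. v \<in> D \<and> tensor_rank ip1 ip2 tensor v \<le> 1}"

end

(* Eckart-Young gives tau_r(u)^2 = sum of sigma_k^2 over k > r, which is convex in r since the
   sigma_k decrease. The n-th iterate started from w of rank at most one has rank at most R^n, so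
   tau at rank floor(R^n) is at most c q^n pi_1(u) (for n = 0 this needs c >= 1). Interpolating
   between the exponents N = floor(log_R r) and N + 1 gives the bound; if c < 1 and N = 0, the
   hypothesis forces r = floor(R), where the estimate for n = 1 applies directly.

   Singular value decompositions are obtained by splitting off leading singular triples one at a
   time; that the singular values do not depend on the decomposition follows from Eckart-Young,
   which expresses the partial sums of sigma_k^2 through approximation errors. *)
theory Submission
  imports Defs
begin

section \<open>Inner product spaces over an abstract scalar field\<close>

text \<open>The tensor product is given only by bilinearity, the inner products of elementary
  tensors and density, so an element \<open>v\<close> does not come as an operator. It is turned
  into one by \<open>ip1 (contraction v y) x = ip v (tensor x y)\<close>. Existence and compactness
  of this map are explicit for elementary tensors and pass to sums, multiples and limits, because
  its operator norm is at most \<open>norm v\<close>. Compactness then supplies the singular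
  vectors. The condition on c and r guards a real failure: take R = 2, r = 1, u of rank 2, D
  consisting of one best rank-one approximation of u, and the map constantly u. The error of the
  best rank-one approximation then equals the initial error and is positive, so no factor c < 1 is
  possible.\<close>

lemma norm_conj [simp]: "norm (conj z) = norm (z :: 'k::rc_field)"
proof (cases "z = 0")
  case True
  then show ?thesis using conj_of_real[of 0, where 'k = 'k] by simp
next
  case False
  have "norm z * norm (conj z) = norm z * norm z"
    using arg_cong[OF mult_conj[of z], of norm] by (simp add: norm_mult power2_eq_square)
  with False show ?thesis by simp
qed

lemma conj_zero [simp]: "conj (0 :: 'k::rc_field) = 0"
  using conj_of_real[of 0, where 'k = 'k] by simp

lemma conj_one [simp]: "conj (1 :: 'k::rc_field) = 1"
  using conj_of_real[of 1, where 'k = 'k] by simp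

text \<open>Needed for the compactness of contraction with an elementary tensor. By the
  classification of the scalars, the ball is a closed subset of a continuous image of an interval or
  a rectangle.\<close>

lemma compact_cball_rc_field: "compact (cball (0 :: 'k::rc_field) M)"
proof -
  consider (real) "\<And>z::'k. z \<in> \<real>"
    | (complex) i :: 'k where "i * i = - 1" "\<And>z. \<exists>a b. z = of_real a + of_real b * i"
    using rc_field_real_or_complex[where 'k = 'k] by blast
  then have "\<exists>C. compact C \<and> cball (0::'k) M \<subseteq> C"
  proof cases
    case real
    have "z \<in> of_real ` {-M..M}" if "norm z \<le> M" for z :: 'k
    proof -
      obtain t where "z = of_real t" using real[of z] by (auto elim: Reals_cases)
      with that show ?thesis by (auto intro!: imageI)
    qed
    moreover have "compact (of_real ` {-M..M} :: 'k set)"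
      by (intro compact_continuous_image continuous_intros) auto
    ultimately show ?thesis by (metis mem_cball_0 subsetI)
  next
    case complex
    \<comment> \<open>The classification says nothing about \<open>conj i\<close>. It is a square
      root of -1, hence i or -i, and i is excluded because fixed points of \<open>conj\<close> are
      real.\<close>
    have ci: "conj i = - i"
    proof -
      have "conj i * conj i = - 1"
        by (metis complex(1) conj_minus conj_mult conj_one)
      then have "(conj i - i) * (conj i + i) = 0"
        using complex(1) by (simp add: algebra_simps)
      moreover have False if fixed: "conj i = i"
      proof -
        obtain t where t: "i = of_real t"
          using conj_fixed_Reals[OF fixed] by (auto elim: Reals_cases)
        have "of_real (t * t + 1) = (0::'k)" using complex(1) t by simp
        then have "t * t + 1 = 0" by (simp only: of_real_eq_0_iff)
        then show False by (smt (verit) zero_le_square)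
      qed
      ultimately show ?thesis by (auto simp: eq_neg_iff_add_eq_0)
    qed
    have ni: "norm i = 1"
    proof -
      have "norm i * norm i = 1" using arg_cong[OF complex(1), of norm] by (simp add: norm_mult)
      then show ?thesis by (smt (verit) norm_ge_zero mult_le_one mult_less_cancel_left2 square_eq_1_iff)
    qed
    \<comment> \<open>The range of b is not sharp: the triangle inequality gives \<bar>b\<bar> \<le>
      \<bar>z\<bar> + \<bar>a\<bar>, hence 2 * M.\<close>
    let ?C = "(\<lambda>(a, b). of_real a + of_real b * i) ` ({-M..M} \<times> {-2*M..2*M})"
    have "z \<in> ?C" if z: "norm z \<le> M" for z :: 'k
    proof -
      obtain a b where ab: "z = of_real a + of_real b * i" using complex(2) by blast
      have "z + conj z = of_real (2 * a)" by (simp add: ab conj_add conj_mult conj_of_real ci)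
      then have "2 * \<bar>a\<bar> = norm (z + conj z)" by simp
      also have "\<dots> \<le> 2 * norm z" using norm_triangle_ineq[of z "conj z"] by simp
      finally have a: "\<bar>a\<bar> \<le> norm z" by simp
      have "\<bar>b\<bar> = norm (z - of_real a)" by (simp add: ab norm_mult ni)
      also have "\<dots> \<le> norm z + \<bar>a\<bar>" using norm_triangle_ineq4[of z "of_real a"] by simp
      finally have "\<bar>b\<bar> \<le> 2 * M" using a z by simp
      with a z have "(a, b) \<in> {-M..M} \<times> {-2*M..2*M}" by auto
      then show ?thesis using ab by force
    qed
    moreover have "compact ?C"
      unfolding case_prod_unfold
      by (intro compact_continuous_image continuous_intros compact_Times) auto
    ultimately show ?thesis by (metis (no_types, lifting) mem_cball_0 subsetI)
  qed
  then show ?thesis using closed_cball compact_Int_closed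
    by (metis inf.absorb_iff2)
qed

section \<open>Cauchy-Schwarz, orthonormal systems and Bessel's inequality\<close>

context hilbert_space
begin

lemma ip_add_right: "ip x (y + z) = ip x y + ip x z"
  by (metis conj_add ip_add ip_commute)

lemma ip_scale_right: "ip x (scale a y) = conj a * ip x y"
  by (metis conj_mult ip_commute ip_scale)

lemma norm_scale: "norm (scale a x) = norm a * norm x"
proof -
  have "of_real ((norm (scale a x))\<^sup>2) = (of_real ((norm a * norm x)\<^sup>2) :: 'k)"
    by (simp add: ip_self[symmetric] power_mult_distrib mult_conj[symmetric] ip_scale
        ip_scale_right mult.assoc del: of_real_power)
  then show ?thesis by (simp only: of_real_eq_iff power2_eq_iff_nonneg norm_ge_zero mult_nonneg_nonneg)
qed

lemma pythagoras:
  assumes "ip x y = 0"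
  shows "(norm (x + y))\<^sup>2 = (norm x)\<^sup>2 + (norm y)\<^sup>2"
proof -
  have "ip y x = 0" using assms by (metis conj_zero ip_commute)
  then have "of_real ((norm (x + y))\<^sup>2) = (of_real ((norm x)\<^sup>2 + (norm y)\<^sup>2) :: 'k)"
    using assms by (simp add: ip_self[symmetric] ip_add ip_add_right del: of_real_power)
  then show ?thesis by (simp only: of_real_eq_iff)
qed

lemma ip_scaleR: "ip (t *\<^sub>R x) y = t *\<^sub>R ip x y"
  by (metis ip_scale scale_of_real scaleR_conv_of_real)

lemma ip_scaleR_right: "ip x (t *\<^sub>R y) = t *\<^sub>R ip x y"
  by (metis conj_of_real ip_scale_right scale_of_real scaleR_conv_of_real)

lemma cauchy_schwarz: "norm (ip x y) \<le> norm x * norm y"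
proof (cases "y = 0")
  case True
  then have "ip x y = 0" using ip_scaleR_right[of x 0 y] by simp
  then show ?thesis by simp
next
  case False
  define a where "a = ip x y / of_real ((norm y)\<^sup>2)"
  define p where "p = x - scale a y"
  have "ip x y = ip p y + ip (scale a y) y"
    by (simp add: ip_add[symmetric] p_def)
  also have "ip (scale a y) y = ip x y"
    using False by (simp add: ip_scale ip_self a_def)
  finally have "ip p y = 0" by simp
  then have "ip p (scale a y) = 0" by (simp add: ip_scale_right)
  from pythagoras[OF this] have "(norm (scale a y))\<^sup>2 \<le> (norm x)\<^sup>2" by (simp add: p_def)
  then have "norm (scale a y) \<le> norm x" by (rule power2_le_imp_le) simp
  moreover have "norm (scale a y) = norm (ip x y) / norm y"
    using False by (simp add: norm_scale a_def norm_divide power2_eq_square norm_mult)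
  ultimately show ?thesis using False by (simp add: divide_le_eq)
qed

text \<open>Over the reals, conjugate linearity in the second argument is plain linearity; this
  makes limits, sums and differences of \<open>ip\<close> available.\<close>

sublocale ip: bounded_bilinear ip
  by (rule bounded_bilinear.intro)
    (use cauchy_schwarz in \<open>auto simp: ip_add ip_add_right ip_scaleR ip_scaleR_right intro!: exI[of _ 1]\<close>)

sublocale scale: bounded_bilinear scale
proof
  show "\<exists>K. \<forall>a b. norm (scale a b) \<le> norm a * norm b * K"
    by (intro exI[of _ 1]) (simp add: norm_scale)
qed (simp_all add: scale_left_distrib scale_right_distrib
    scaleR_conv_of_real scale_of_real[symmetric] mult.commute)

lemma ip_eq_0_commute: "ip x y = 0 \<longleftrightarrow> ip y x = 0"
  by (metis conj_zero ip_commute)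

lemma ip_ext:
  assumes "\<And>x. ip s x = ip t x"
  shows "s = t"
proof -
  have "ip (s - t) (s - t) = 0" using assms by (simp add: ip.diff_left)
  then show ?thesis by (simp add: ip_self)
qed

lemma orthonormal_on_norm:
  assumes "orthonormal_on ip K e" "k \<in> K"
  shows "norm (e k) = 1"
proof -
  have "of_real ((norm (e k))\<^sup>2) = (of_real 1 :: 'k)"
    using assms by (simp add: orthonormal_on_def ip_self[symmetric] del: of_real_power)
  then have "(norm (e k))\<^sup>2 = 1" by (simp only: of_real_eq_iff)
  then show ?thesis by (smt (verit) norm_ge_zero power2_eq_1_iff)
qed

lemma norm_sum_orthonormal:
  assumes "finite K" "orthonormal_on ip K e"
  shows "(norm (\<Sum>k\<in>K. scale (a k) (e k)))\<^sup>2 = (\<Sum>k\<in>K. (norm (a k))\<^sup>2)"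
  using assms
proof (induction K)
  case (insert k K)
  have *: "orthonormal_on ip K e" "norm (e k) = 1"
    using insert.prems orthonormal_on_norm[OF insert.prems, of k] by (auto simp: orthonormal_on_def)
  have "ip (scale (a k) (e k)) (\<Sum>j\<in>K. scale (a j) (e j)) = 0"
    unfolding ip.sum_right using insert
    by (intro sum.neutral) (auto simp: ip_scale ip_scale_right orthonormal_on_def)
  from pythagoras[OF this] show ?case
    using insert * by (simp add: norm_scale)
qed simp

lemma ip_sum_orthonormal:
  assumes "finite K" "orthonormal_on ip K e" "j \<in> K"
  shows "ip (\<Sum>k\<in>K. scale (a k) (e k)) (e j) = a j"
proof -
  have "ip (\<Sum>k\<in>K. scale (a k) (e k)) (e j) = (\<Sum>k\<in>K. if k = j then a k else 0)"
    unfolding ip.sum_left using assms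
    by (intro sum.cong) (auto simp: ip_scale orthonormal_on_def)
  with assms show ?thesis by simp
qed

lemma ip_bessel_residual:
  assumes "finite K" "orthonormal_on ip K e" "j \<in> K"
  shows "ip (x - (\<Sum>k\<in>K. scale (ip x (e k)) (e k))) (e j) = 0"
  using ip_sum_orthonormal[OF assms, of "\<lambda>k. ip x (e k)"] by (simp add: ip.diff_left)

text \<open>Bessel's inequality with its defect. The equality identifies a vector with its
  projection when the defect vanishes, and otherwise measures what a projection leaves.\<close>

lemma norm_bessel_residual:
  assumes "finite K" "orthonormal_on ip K e"
  shows "(norm (x - (\<Sum>k\<in>K. scale (ip x (e k)) (e k))))\<^sup>2
    = (norm x)\<^sup>2 - (\<Sum>k\<in>K. (norm (ip x (e k)))\<^sup>2)"
proof -
  let ?s = "\<Sum>k\<in>K. scale (ip x (e k)) (e k)"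
  have "ip (x - ?s) ?s = 0"
    using ip_bessel_residual[OF assms]
    by (simp add: ip.sum_right[of "x - ?s"] ip_scale_right)
  from pythagoras[OF this] show ?thesis
    using norm_sum_orthonormal[OF assms, of "\<lambda>k. ip x (e k)"] by simp
qed

lemma bessel:
  assumes "finite K" "orthonormal_on ip K e"
  shows "(\<Sum>k\<in>K. (norm (ip x (e k)))\<^sup>2) \<le> (norm x)\<^sup>2"
  using norm_bessel_residual[OF assms, of x]
  by (smt (verit) zero_le_power2)

text \<open>Gram-Schmidt, stated through the orthogonal complement. The count m can fall short of r,
  since a vector in the span of the system built so far adds nothing.\<close>

lemma ex_orthonormal_annihilator:
  fixes a :: "nat \<Rightarrow> 'h"
  shows "\<exists>m\<le>r. \<exists>g. orthonormal_on ip {..<m} g \<and>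
    (\<forall>x. (\<forall>i<m. ip x (g i) = 0) \<longrightarrow> (\<forall>i<r. ip x (a i) = 0))"
proof (induction r)
  case 0
  show ?case by (intro exI[of _ 0]) (auto simp: orthonormal_on_def)
next
  case (Suc r)
  then obtain m g where mg: "m \<le> r" "orthonormal_on ip {..<m} g"
    "\<And>x i. (\<forall>i<m. ip x (g i) = 0) \<Longrightarrow> i < r \<Longrightarrow> ip x (a i) = 0" by blast
  define s where "s = (\<Sum>k<m. scale (ip (a r) (g k)) (g k))"
  define p where "p = a r - s"
  have s: "ip x s = 0" if "\<And>i. i < m \<Longrightarrow> ip x (g i) = 0" for x
    using that by (simp add: s_def ip.sum_right ip_scale_right)
  have pg: "ip p (g j) = 0" if "j < m" for j
    using ip_bessel_residual[OF _ mg(2), of j "a r"] that by (simp add: p_def s_def)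
  show ?case
  proof (cases "p = 0")
    case True
    then have "ip x (a r) = 0" if "\<forall>i<m. ip x (g i) = 0" for x
      using s[of x] that by (simp add: p_def)
    with mg show ?thesis
      by (intro exI[of _ m] conjI exI[of _ g]) (auto simp: less_Suc_eq)
  next
    case False
    define h where "h = (1 / norm p) *\<^sub>R p"
    have h: "ip h h = 1" "\<And>j. j < m \<Longrightarrow> ip h (g j) = 0"
      using False pg by (simp_all add: h_def ip_scaleR ip_scaleR_right ip_self
          power2_eq_square scaleR_conv_of_real)
    have on: "orthonormal_on ip {..<Suc m} (g(m := h))"
      using mg(2) h ip_eq_0_commute
      by (auto simp: orthonormal_on_def less_Suc_eq)
    have "ip x (a i) = 0" if x: "\<forall>i<Suc m. ip x ((g(m := h)) i) = 0" and i: "i < Suc r" for x i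
    proof -
      have xg: "\<And>i. i < m \<Longrightarrow> ip x (g i) = 0" and xh: "ip x h = 0"
        using x by (auto simp: less_Suc_eq)
      have "ip x (a r) = ip x p + ip x s" by (simp add: p_def ip_add_right[symmetric])
      also have "ip x p = 0" using xh False by (simp add: h_def ip_scaleR_right)
      finally show ?thesis using s[OF xg] mg(3)[of x i] xg i by (auto simp: less_Suc_eq)
    qed
    with on mg(1) show ?thesis
      by (intro exI[of _ "Suc m"] conjI exI[of _ "g(m := h)"]) (auto simp del: fun_upd_apply)
  qed
qed

end

section \<open>Contraction of a tensor with a vector\<close>

context hilbert_space
begin

lemma subspace_closureI:
  assumes "closed S" "subspace S" "A \<subseteq> S" "closure (span A) = UNIV"
  shows "S = UNIV"
  by (metis assms closure_minimal span_minimal top.extremum_uniqueI)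

text \<open>Induction over a dense span: a property of the generators that survives sums, multiples
  and limits holds everywhere.\<close>

lemma mem_subspace_closureI:
  assumes "closure (span A) = UNIV" and "closed S" "A \<subseteq> S" "0 \<in> S"
    and "\<And>x y. x \<in> S \<Longrightarrow> y \<in> S \<Longrightarrow> x + y \<in> S" "\<And>a x. x \<in> S \<Longrightarrow> scale a x \<in> S"
  shows "v \<in> S"
  using subspace_closureI[OF assms(2) subspaceI assms(3,1)] assms(4-6) by blast

end

context hilbert_tensor_product
begin

text \<open>Exchanging the factors makes contraction available with vectors of the first factor as
  well.\<close>

lemma flip: "hilbert_tensor_product scale2 ip2 scale1 ip1 scale ip (\<lambda>y x. tensor x y)"
proof -
  have "{tensor x y |y x. True} = {tensor x y |x y. True}" by blast
  then show ?thesis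
    by unfold_locales
      (simp_all add: tensor_add_left tensor_add_right tensor_scale_left tensor_scale_right
        ip_tensor mult.commute tensor_dense[simplified])
qed

lemma norm_tensor: "norm (tensor x y) = norm x * norm y"
proof -
  have "of_real ((norm (tensor x y))\<^sup>2) = (of_real ((norm x * norm y)\<^sup>2) :: 'k)"
    by (simp only: H.ip_self[symmetric] ip_tensor H1.ip_self H2.ip_self power_mult_distrib of_real_mult)
  then show ?thesis
    by (simp only: of_real_eq_iff power2_eq_iff_nonneg norm_ge_zero mult_nonneg_nonneg)
qed

sublocale tensor: bounded_bilinear tensor
proof
  show "\<exists>K. \<forall>a b. norm (tensor a b) \<le> norm a * norm b * K"
    by (intro exI[of _ 1]) (simp add: norm_tensor)
  show "tensor (r *\<^sub>R a) b = r *\<^sub>R tensor a b" for r a b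
    by (metis H1.scale_of_real H.scale_of_real tensor_scale_left)
  show "tensor a (r *\<^sub>R b) = r *\<^sub>R tensor a b" for r a b
    by (metis H2.scale_of_real H.scale_of_real tensor_scale_right)
qed (simp_all add: tensor_add_left tensor_add_right)

text \<open>Test the representation with x = t. It is stated for any representative because the
  existence proof uses it before \<open>contraction\<close> is defined.\<close>

lemma contraction_bound:
  assumes "\<And>x. ip1 t x = ip v (tensor x y)"
  shows "norm t \<le> norm v * norm y"
proof (cases "t = 0")
  case False
  have "(norm t)\<^sup>2 = norm (ip1 t t)" by (simp add: H1.ip_self norm_power)
  also have "\<dots> \<le> norm v * (norm t * norm y)"
    unfolding assms norm_tensor[symmetric] by (rule H.cauchy_schwarz)
  finally have "norm t * norm t \<le> norm t * (norm v * norm y)"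
    by (simp add: power2_eq_square mult_ac)
  with False show ?thesis by simp
qed simp

text \<open>Riesz representation by density: elementary tensors have an explicit representative, and
  the preceding bound makes representatives along a convergent sequence Cauchy.\<close>

lemma ex_contraction: "\<exists>t. \<forall>x. ip1 t x = ip v (tensor x y)"
proof -
  let ?S = "{v. \<exists>t. \<forall>x. ip1 t x = ip v (tensor x y)}"
  have "v \<in> ?S"
  proof (rule H.mem_subspace_closureI[OF tensor_dense])
    show "closed ?S"
      unfolding closed_sequential_limits
    proof (intro allI impI, elim conjE)
      fix w l assume w: "\<forall>n. w n \<in> ?S" and l: "w \<longlonglongrightarrow> l"
      obtain t where t: "\<And>n x. ip1 (t n) x = ip (w n) (tensor x y)"
        using w unfolding mem_Collect_eq by metis
      have d: "norm (t m - t n) \<le> norm (w m - w n) * norm y" for m n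
        by (rule contraction_bound) (simp add: H1.ip.diff_left H.ip.diff_left t)
      \<comment> \<open>Moving \<open>norm y\<close> into the sequence avoids dividing by it in
        \<open>d\<close>; it may be 0.\<close>
      have "Cauchy (\<lambda>n. norm y *\<^sub>R w n)"
        using l by (intro LIMSEQ_imp_Cauchy) (rule tendsto_scaleR[OF tendsto_const])
      then have "Cauchy t"
        using d unfolding Cauchy_def dist_norm
        by (simp add: scaleR_right_diff_distrib[symmetric] mult.commute)
          (meson le_less_trans)
      then obtain s where s: "t \<longlonglongrightarrow> s" using Cauchy_convergent convergent_def by blast
      have "ip1 s x = ip l (tensor x y)" for x
      proof (rule LIMSEQ_unique)
        show "(\<lambda>n. ip1 (t n) x) \<longlonglongrightarrow> ip1 s x"
          by (intro H1.ip.tendsto s tendsto_const)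
        show "(\<lambda>n. ip1 (t n) x) \<longlonglongrightarrow> ip l (tensor x y)"
          unfolding t by (intro H.ip.tendsto l tendsto_const)
      qed
      then show "l \<in> ?S" by blast
    qed
    show "{tensor x y |x y. True} \<subseteq> ?S"
    proof clarify
      fix a b
      show "\<exists>t. \<forall>x. ip1 t x = ip (tensor a b) (tensor x y)"
        by (rule exI[of _ "scale1 (ip2 b y) a"]) (simp add: ip_tensor H1.ip_scale mult.commute)
    qed
    show "0 \<in> ?S" by (auto intro!: exI[of _ 0] simp: H1.ip.zero_left H.ip.zero_left)
    show "v + w \<in> ?S" if "v \<in> ?S" "w \<in> ?S" for v w
      using that by (auto simp: H.ip_add) (metis H1.ip_add)
    show "scale a v \<in> ?S" if "v \<in> ?S" for a v
      using that by (auto simp: H.ip_scale) (metis H1.ip_scale)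
  qed
  then show ?thesis by simp
qed

text \<open>The Hilbert-Schmidt operator of v, conjugate linear in y. The choice is unique by
  \<open>ip_ext\<close>.\<close>

definition contraction where
  "contraction v y = (SOME t. \<forall>x. ip1 t x = ip v (tensor x y))"

lemma ip_contraction: "ip1 (contraction v y) x = ip v (tensor x y)"
  unfolding contraction_def using someI_ex[OF ex_contraction] by blast

lemma norm_contraction_le: "norm (contraction v y) \<le> norm v * norm y"
  by (rule contraction_bound) (rule ip_contraction)

lemma contraction_eqI: "(\<And>x. ip1 t x = ip v (tensor x y)) \<Longrightarrow> contraction v y = t"
  by (rule H1.ip_ext) (simp add: ip_contraction)

lemma contraction_add: "contraction (v + w) y = contraction v y + contraction w y"
  by (rule contraction_eqI) (simp add: H1.ip_add H.ip_add ip_contraction)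

lemma contraction_diff: "contraction (v - w) y = contraction v y - contraction w y"
  by (rule contraction_eqI) (simp add: H1.ip.diff_left H.ip.diff_left ip_contraction)

lemma contraction_scale: "contraction (scale a v) y = scale1 a (contraction v y)"
  by (rule contraction_eqI) (simp add: H1.ip_scale H.ip_scale ip_contraction)

lemma contraction_zero: "contraction 0 y = 0"
  by (rule contraction_eqI) (simp add: H1.ip.zero_left H.ip.zero_left)

lemma contraction_tensor: "contraction (tensor a b) y = scale1 (ip2 b y) a"
  by (rule contraction_eqI) (simp add: H1.ip_scale ip_tensor mult.commute)

lemma contraction_scaleR: "contraction v (r *\<^sub>R y) = r *\<^sub>R contraction v y"
  by (rule contraction_eqI)
    (simp add: H1.ip_scaleR ip_contraction tensor.scaleR_right H.ip_scaleR_right)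

text \<open>Compactness of the contraction map, in the form of finite nets. Elementary tensors give
  maps of rank at most one, and a net for w serves a nearby v since on the unit ball the two maps
  differ by at most \<open>norm (w - v)\<close>.\<close>

lemma contraction_totally_bounded:
  "\<forall>\<epsilon>>0. \<exists>F. finite F \<and> (\<forall>y. norm y \<le> 1 \<longrightarrow> (\<exists>t\<in>F. dist t (contraction v y) < \<epsilon>))"
proof -
  let ?S = "{v. \<forall>\<epsilon>>0. \<exists>F. finite F \<and> (\<forall>y. norm y \<le> 1 \<longrightarrow> (\<exists>t\<in>F. dist t (contraction v y) < \<epsilon>))}"
  have "v \<in> ?S"
  proof (rule H.mem_subspace_closureI[OF tensor_dense])
    show "closed ?S"
      unfolding closure_subset_eq[symmetric]
    proof clarify
      fix v and \<epsilon> :: real assume "v \<in> closure ?S" "0 < \<epsilon>"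
      then obtain w where w: "w \<in> ?S" "dist w v < \<epsilon>/2"
        unfolding closure_approachable by (meson half_gt_zero)
      then obtain F where F: "finite F" "\<And>y. norm y \<le> 1 \<Longrightarrow> \<exists>t\<in>F. dist t (contraction w y) < \<epsilon>/2"
        using \<open>0 < \<epsilon>\<close> by (auto dest!: spec[of _ "\<epsilon>/2"])
      have "\<exists>t\<in>F. dist t (contraction v y) < \<epsilon>" if y: "norm y \<le> 1" for y
      proof -
        obtain t where t: "t \<in> F" "dist t (contraction w y) < \<epsilon>/2" using F(2) y by blast
        have "dist (contraction w y) (contraction v y) \<le> norm (w - v) * norm y"
          unfolding dist_norm contraction_diff[symmetric] by (rule norm_contraction_le)
        also have "\<dots> \<le> norm (w - v)" using y by (simp add: mult_left_le)
        also have "\<dots> < \<epsilon>/2" using w by (simp add: dist_norm)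
        finally show ?thesis using t dist_triangle_half_r dist_triangle_half_l
          by (metis dist_commute)
      qed
      with F(1) show "\<exists>F. finite F \<and> (\<forall>y. norm y \<le> 1 \<longrightarrow> (\<exists>t\<in>F. dist t (contraction v y) < \<epsilon>))"
        by blast
    qed
    show "{tensor x y |x y. True} \<subseteq> ?S"
    proof clarify
      fix a :: 'a and b :: 'b and \<epsilon> :: real assume "0 < \<epsilon>"
      \<comment> \<open>The unit ball is sent to multiples of a by scalars of size at most
        \<open>norm b\<close>.\<close>
      have "compact ((\<lambda>z. scale1 z a) ` cball 0 (norm b))"
        by (intro compact_continuous_image compact_cball_rc_field
            linear_continuous_on H1.scale.bounded_linear_left)
      then obtain F where F: "finite F" "(\<lambda>z. scale1 z a) ` cball 0 (norm b) \<subseteq> (\<Union>t\<in>F. ball t \<epsilon>)"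
        unfolding compact_eq_totally_bounded using \<open>0 < \<epsilon>\<close> by blast
      have "\<exists>t\<in>F. dist t (contraction (tensor a b) y) < \<epsilon>" if "norm y \<le> 1" for y
      proof -
        have "norm (ip2 b y) \<le> norm b"
          using H2.cauchy_schwarz[of b y] that by (smt (verit) mult_left_le norm_ge_zero)
        then have "contraction (tensor a b) y \<in> (\<lambda>z. scale1 z a) ` cball 0 (norm b)"
          by (auto simp: contraction_tensor intro!: imageI)
        with F(2) show ?thesis by (meson UN_E mem_ball subsetD)
      qed
      with F(1)
      show "\<exists>F. finite F \<and> (\<forall>y. norm y \<le> 1 \<longrightarrow> (\<exists>t\<in>F. dist t (contraction (tensor a b) y) < \<epsilon>))"
        by blast
    qed
    show "0 \<in> ?S" by (auto simp: contraction_zero intro!: exI[of _ "{0}"])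
    show "v + w \<in> ?S" if vw: "v \<in> ?S" "w \<in> ?S" for v w
    proof clarify
      fix \<epsilon> :: real assume "0 < \<epsilon>"
      then have "0 < \<epsilon>/2" by simp
      then obtain F G where F: "finite F" "\<And>y. norm y \<le> 1 \<Longrightarrow> \<exists>t\<in>F. dist t (contraction v y) < \<epsilon>/2"
        and G: "finite G" "\<And>y. norm y \<le> 1 \<Longrightarrow> \<exists>t\<in>G. dist t (contraction w y) < \<epsilon>/2"
        using vw unfolding mem_Collect_eq by meson
      have "\<exists>t\<in>(\<lambda>(s, t). s + t) ` (F \<times> G). dist t (contraction (v + w) y) < \<epsilon>"
        if y: "norm y \<le> 1" for y
      proof -
        obtain s t where st: "s \<in> F" "t \<in> G"
          "dist s (contraction v y) < \<epsilon>/2" "dist t (contraction w y) < \<epsilon>/2"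
          using F(2)[OF y] G(2)[OF y] by blast
        then have "dist (s + t) (contraction v y + contraction w y) < \<epsilon>"
          using dist_triangle_add[of s t "contraction v y" "contraction w y"] by simp
        with st show ?thesis by (force simp: contraction_add)
      qed
      with F(1) G(1)
      show "\<exists>F. finite F \<and> (\<forall>y. norm y \<le> 1 \<longrightarrow> (\<exists>t\<in>F. dist t (contraction (v + w) y) < \<epsilon>))"
        by (intro exI[of _ "(\<lambda>(s, t). s + t) ` (F \<times> G)"]) blast
    qed
    show "scale a v \<in> ?S" if v: "v \<in> ?S" for a v
    proof clarify
      fix \<epsilon> :: real assume e: "0 < \<epsilon>"
      \<comment> \<open>The summand 1 covers a = 0 and makes the final estimate strict.\<close>
      define \<delta> where "\<delta> = \<epsilon> / (norm a + 1)"
      have a: "0 < norm a + 1" by (simp add: add_nonneg_pos)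
      with e have "0 < \<delta>" by (simp add: \<delta>_def)
      then obtain F where F: "finite F" "\<And>y. norm y \<le> 1 \<Longrightarrow> \<exists>t\<in>F. dist t (contraction v y) < \<delta>"
        using v by blast
      have "\<exists>t\<in>scale1 a ` F. dist t (contraction (scale a v) y) < \<epsilon>" if y: "norm y \<le> 1" for y
      proof -
        obtain t where t: "t \<in> F" "dist t (contraction v y) < \<delta>" using F(2)[OF y] by blast
        have "dist (scale1 a t) (scale1 a (contraction v y)) = norm a * dist t (contraction v y)"
          by (simp add: dist_norm H1.scale.diff_right[symmetric] H1.norm_scale)
        also have "\<dots> \<le> norm a * \<delta>" using t by (simp add: mult_left_mono)
        also have "\<dots> < (norm a + 1) * \<delta>" using \<open>0 < \<delta>\<close> by simp
        also have "\<dots> = \<epsilon>" using a by (simp add: \<delta>_def)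
        finally show ?thesis using t(1) by (auto simp: contraction_scale)
      qed
      with F(1)
      show "\<exists>F. finite F \<and> (\<forall>y. norm y \<le> 1 \<longrightarrow> (\<exists>t\<in>F. dist t (contraction (scale a v) y) < \<epsilon>))"
        by (intro exI[of _ "scale1 a ` F"]) blast
    qed
  qed
  then show ?thesis by simp
qed

lemma contraction_convergent_subsequence:
  fixes y :: "nat \<Rightarrow> 'b"
  assumes "\<And>n. norm (y n) \<le> 1"
  shows "\<exists>l r. strict_mono (r :: nat \<Rightarrow> nat) \<and> (\<lambda>n. contraction v (y (r n))) \<longlonglongrightarrow> l"
proof -
  let ?X = "contraction v ` {y. norm y \<le> 1}"
  have "\<exists>F. finite F \<and> closure ?X \<subseteq> (\<Union>t\<in>F. ball t \<epsilon>)" if "0 < \<epsilon>" for \<epsilon>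
  proof -
    obtain F where F: "finite F" "\<And>y. norm y \<le> 1 \<Longrightarrow> \<exists>t\<in>F. dist t (contraction v y) < \<epsilon>/2"
      using contraction_totally_bounded[of v] \<open>0 < \<epsilon>\<close> by (metis half_gt_zero)
    \<comment> \<open>Closed balls of half the radius have a closed finite union, so the same
      centres also serve the closure.\<close>
    have "?X \<subseteq> (\<Union>t\<in>F. cball t (\<epsilon>/2))" using F(2) by (fastforce intro: less_imp_le)
    moreover have "closed (\<Union>t\<in>F. cball t (\<epsilon>/2))" using F(1) by (intro closed_UN) auto
    ultimately have "closure ?X \<subseteq> (\<Union>t\<in>F. cball t (\<epsilon>/2))" by (rule closure_minimal)
    also have "\<dots> \<subseteq> (\<Union>t\<in>F. ball t \<epsilon>)" using \<open>0 < \<epsilon>\<close> by fastforce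
    finally show ?thesis using F(1) by blast
  qed
  then have "compact (closure ?X)"
    unfolding compact_eq_totally_bounded by (simp add: complete_eq_closed)
  moreover have "contraction v (y n) \<in> closure ?X" for n
    using assms closure_subset by fastforce
  ultimately obtain l r where "strict_mono r" "((\<lambda>n. contraction v (y n)) \<circ> r) \<longlonglongrightarrow> l"
    unfolding compact_def by metis
  then show ?thesis by (auto simp: o_def)
qed

end

section \<open>Existence of the singular value decomposition\<close>

context hilbert_tensor_product
begin

text \<open>The conjugate linear adjoint of \<open>contraction v\<close>: pairing it with y gives
  the same number as pairing \<open>contraction v y\<close> with x.\<close>

abbreviation (input) contraction_flip where
  "contraction_flip \<equiv> hilbert_tensor_product.contraction ip2 ip (\<lambda>y x. tensor x y)"

lemma ip_contraction_flip: "ip2 (contraction_flip v x) y = ip v (tensor x y)"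
  by (rule hilbert_tensor_product.ip_contraction[OF flip])

text \<open>The scalar \<open>s\<close> is the operator norm of the contraction map; compactness of that map yields
  the vectors \<open>e\<close> and \<open>f\<close>.\<close>

lemma ex_leading_singular_triple:
  "\<exists>s e f. 0 \<le> s \<and> (0 < s \<longrightarrow> norm e = 1 \<and> norm f = 1) \<and>
     (\<forall>x y. norm (ip v (tensor x y)) \<le> s * (norm x * norm y)) \<and>
     (\<forall>x. ip v (tensor x f) = s *\<^sub>R ip1 e x) \<and> (\<forall>y. ip v (tensor e y) = s *\<^sub>R ip2 f y)"
proof -
  let ?N = "(\<lambda>y. norm (contraction v y)) ` {y. norm y \<le> 1}"
  define s where "s = Sup ?N"
  have bdd: "bdd_above ?N"
    using norm_contraction_le[of v] by (intro bdd_aboveI2[of _ _ "norm v"])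
      (metis mem_Collect_eq mult_left_le norm_ge_zero order_trans)
  have le_s: "norm (contraction v y) \<le> s" if "norm y \<le> 1" for y
    unfolding s_def using that bdd by (intro cSup_upper) auto
  have s0: "0 \<le> s" using order_trans[OF norm_ge_zero le_s[of 0]] by simp
  have le: "norm (contraction v y) \<le> s * norm y" for y
  proof (cases "y = 0")
    case False
    then have "norm (contraction v ((1 / norm y) *\<^sub>R y)) \<le> s" by (intro le_s) simp
    with False show ?thesis by (simp add: contraction_scaleR divide_le_eq)
  next
    case True
    then show ?thesis using norm_contraction_le[of v 0] by simp
  qed
  have bound: "norm (ip v (tensor x y)) \<le> s * (norm x * norm y)" for x y
  proof -
    have "norm (ip v (tensor x y)) \<le> norm (contraction v y) * norm x"
      unfolding ip_contraction[symmetric] by (rule H1.cauchy_schwarz)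
    also have "\<dots> \<le> s * norm y * norm x" by (intro mult_right_mono le) simp
    finally show ?thesis by (simp add: mult_ac)
  qed
  show ?thesis
  proof (cases "s = 0")
    case True
    with bound have "ip v (tensor x y) = 0" for x y by simp
    \<comment> \<open>Zero vectors suffice, since unit norm is demanded only for 0 < s.\<close>
    then show ?thesis by (intro exI[of _ 0]) simp
  next
    case False
    with s0 have s: "0 < s" by simp
    have "\<exists>y. norm y \<le> 1 \<and> s - 1 / Suc n < norm (contraction v y)" for n
    proof -
      have "?N \<noteq> {}" by (auto intro!: exI[of _ 0])
      then obtain a where "a \<in> ?N" "s - 1 / Suc n < a"
        using less_cSup_iff[OF _ bdd, of "s - 1 / Suc n"] by (auto simp: s_def)
      then show ?thesis by auto
    qed
    then obtain y where y: "\<And>n. norm (y n) \<le> 1"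
      and near: "\<And>n. s - 1 / Suc n < norm (contraction v (y n))" by metis
    have lim_s: "(\<lambda>n. norm (contraction v (y n))) \<longlonglongrightarrow> s"
    proof (rule real_tendsto_sandwich[where h = "\<lambda>_. s"])
      show "(\<lambda>n. s - 1 / Suc n) \<longlonglongrightarrow> s"
        using tendsto_diff[OF tendsto_const LIMSEQ_inverse_real_of_nat, of s]
        by (simp add: inverse_eq_divide)
    qed (use near le_s[OF y] in \<open>auto intro: always_eventually less_imp_le\<close>)
    obtain l r where r: "strict_mono (r :: nat \<Rightarrow> nat)"
      and l: "(\<lambda>n. contraction v (y (r n))) \<longlonglongrightarrow> l"
      using contraction_convergent_subsequence[of y v] y by blast
    have "(\<lambda>n. norm (contraction v (y (r n)))) \<longlonglongrightarrow> s"
      using LIMSEQ_subseq_LIMSEQ[OF lim_s r] by (simp add: o_def)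
    with tendsto_norm[OF l] have nl: "norm l = s" using LIMSEQ_unique by blast
    \<comment> \<open>Compactness gives convergence of the images only, not of the maximizing
      vectors y. Hence e is the normalized limit of the images, and f is obtained from the adjoint
      applied to e.\<close>
    define e where "e = (1 / s) *\<^sub>R l"
    have le: "l = s *\<^sub>R e" and ne: "norm e = 1" using s nl by (simp_all add: e_def)
    define t where "t = contraction_flip v e"
    have t_le: "norm t \<le> s"
    proof -
      have "norm t * norm t = norm (ip2 t t)"
        by (simp add: H2.ip_self norm_power power2_eq_square norm_mult)
      also have "\<dots> = norm (ip v (tensor e t))" unfolding t_def ip_contraction_flip ..
      also have "\<dots> \<le> s * norm t" using bound[of e t] ne by simp
      finally show ?thesis using s0 by (cases "t = 0") auto
    qed
    \<comment> \<open>The pairings of the images with e tend to s, and each of them is a pairing of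
      t with a vector of norm at most 1.\<close>
    have t_ge: "s \<le> norm t"
    proof (rule LIMSEQ_le_const2)
      have "(\<lambda>n. norm (ip1 (contraction v (y (r n))) e)) \<longlonglongrightarrow> norm (ip1 l e)"
        by (intro tendsto_norm H1.ip.tendsto l tendsto_const)
      also have "norm (ip1 l e) = s"
        using s ne by (simp add: le H1.ip_scaleR H1.ip_self)
      finally show "(\<lambda>n. norm (ip1 (contraction v (y (r n))) e)) \<longlonglongrightarrow> s" .
      have "norm (ip1 (contraction v (y (r n))) e) \<le> norm t" for n
      proof -
        have "norm (ip1 (contraction v (y (r n))) e) = norm (ip2 t (y (r n)))"
          by (simp add: t_def ip_contraction_flip ip_contraction)
        also have "\<dots> \<le> norm t * norm (y (r n))" by (rule H2.cauchy_schwarz)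
        also have "\<dots> \<le> norm t" using y[of "r n"] by (simp add: mult_left_le)
        finally show ?thesis .
      qed
      then show "\<exists>N. \<forall>n\<ge>N. norm (ip1 (contraction v (y (r n))) e) \<le> norm t" by blast
    qed
    define f where "f = (1 / s) *\<^sub>R t"
    have tf: "t = s *\<^sub>R f" and nf: "norm f = 1" using s t_le t_ge by (simp_all add: f_def)
    have e_left: "ip v (tensor e z) = s *\<^sub>R ip2 f z" for z
      by (simp add: ip_contraction_flip[symmetric] t_def[symmetric] tf H2.ip_scaleR)
    define g where "g = contraction v f"
    have ge: "ip1 g e = of_real s"
      using e_left[of f] nf by (simp add: g_def ip_contraction H2.ip_self scaleR_conv_of_real)
    \<comment> \<open>The norm of g is at most s, while its component along e is already s; the
      Bessel defect therefore leaves no other component.\<close>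
    have "orthonormal_on ip1 {0} (\<lambda>_. e)" using ne by (simp add: orthonormal_on_def H1.ip_self)
    from H1.norm_bessel_residual[OF _ this, of g]
    have "(norm (g - s *\<^sub>R e))\<^sup>2 = (norm g)\<^sup>2 - s\<^sup>2"
      by (simp add: ge H1.scale_of_real)
    also have "\<dots> \<le> 0" using le_s[of f] nf s0 by (simp add: g_def power_mono)
    finally have "g = s *\<^sub>R e" by simp
    then have "ip v (tensor x f) = s *\<^sub>R ip1 e x" for x
      by (simp add: ip_contraction[symmetric] g_def[symmetric] H1.ip_scaleR)
    with s0 ne nf bound e_left show ?thesis by blast
  qed
qed

lemma eq_0_if_ip_tensor_eq_0:
  assumes "\<And>x y. ip z (tensor x y) = 0"
  shows "z = 0"
proof -
  have "w \<in> {w. ip z w = 0}" for w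
  proof (rule H.mem_subspace_closureI[OF tensor_dense])
    show "closed {w. ip z w = 0}"
      by (intro closed_Collect_eq continuous_intros linear_continuous_on
          H.ip.bounded_linear_right)
  qed (use assms in \<open>auto simp: H.ip_add_right H.ip_scale_right H.ip.zero_right\<close>)
  then have "ip z z = 0" by simp
  then show ?thesis by (simp add: H.ip_self)
qed

lemma orthonormal_on_tensor:
  assumes "orthonormal_on ip1 K e" "orthonormal_on ip2 K f"
  shows "orthonormal_on ip K (\<lambda>k. tensor (e k) (f k))"
  using assms by (simp add: orthonormal_on_def ip_tensor)

end

section \<open>Series along orthonormal systems\<close>

context hilbert_space
begin

text \<open>A may leave K where the coefficients vanish, because singular vectors are unconstrained
  at singular value 0.\<close>

lemma norm_sum_scaleR_orthonormal:
  assumes "finite A" "orthonormal_on ip K E" "\<And>k. k \<in> A \<Longrightarrow> k \<notin> K \<Longrightarrow> a k = 0"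
  shows "(norm (\<Sum>k\<in>A. a k *\<^sub>R E k))\<^sup>2 = (\<Sum>k\<in>A. (a k)\<^sup>2)"
proof -
  have "orthonormal_on ip (A \<inter> K) E" using assms(2) by (auto simp: orthonormal_on_def)
  from norm_sum_orthonormal[OF _ this, of "\<lambda>k. of_real (a k)"] assms(1)
  have "(norm (\<Sum>k\<in>A \<inter> K. a k *\<^sub>R E k))\<^sup>2 = (\<Sum>k\<in>A \<inter> K. (a k)\<^sup>2)"
    by (simp add: scale_of_real)
  moreover have "(\<Sum>k\<in>A. a k *\<^sub>R E k) = (\<Sum>k\<in>A \<inter> K. a k *\<^sub>R E k)"
    "(\<Sum>k\<in>A. (a k)\<^sup>2) = (\<Sum>k\<in>A \<inter> K. (a k)\<^sup>2)"
    using assms(1,3) by (intro sum.mono_neutral_right; auto)+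
  ultimately show ?thesis by simp
qed

lemma summable_orthonormal:
  assumes E: "orthonormal_on ip K E" "\<And>k. k \<notin> K \<Longrightarrow> a k = 0"
    and a: "summable (\<lambda>k. (a k)\<^sup>2)"
  shows "summable (\<lambda>k. a k *\<^sub>R E k)"
  unfolding summable_Cauchy
proof (intro allI impI)
  fix \<epsilon> :: real assume e: "0 < \<epsilon>"
  then obtain N where N: "\<And>m n. m \<ge> N \<Longrightarrow> norm (\<Sum>k=m..<n. (a k)\<^sup>2) < \<epsilon>\<^sup>2"
    using a unfolding summable_Cauchy by (metis zero_less_power)
  have "norm (\<Sum>k=m..<n. a k *\<^sub>R E k) < \<epsilon>" if "m \<ge> N" for m n
  proof (rule power2_less_imp_less)
    show "(norm (\<Sum>k=m..<n. a k *\<^sub>R E k))\<^sup>2 < \<epsilon>\<^sup>2"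
      using N[OF that, of n] norm_sum_scaleR_orthonormal[OF _ E, of "{m..<n}"]
      by (auto simp: abs_of_nonneg sum_nonneg)
  qed (use e in simp)
  then show "\<exists>N. \<forall>m\<ge>N. \<forall>n. norm (\<Sum>k=m..<n. a k *\<^sub>R E k) < \<epsilon>" by blast
qed

end

context hilbert_tensor_product
begin

text \<open>Once s = 0, \<open>step\<close> changes nothing, so the recursion pads a finite
  decomposition with zeros and needs no case distinction on dimension.\<close>

theorem ex_svd: "\<exists>\<sigma> e f. is_svd ip1 ip2 tensor v \<sigma> e f"
proof -
  obtain s e f where s0: "\<And>w. 0 \<le> s w"
    and nrm: "\<And>w. 0 < s w \<Longrightarrow> norm (e w) = 1" "\<And>w. 0 < s w \<Longrightarrow> norm (f w) = 1"
    and bound: "\<And>w x y. norm (ip w (tensor x y)) \<le> s w * (norm x * norm y)"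
    and right: "\<And>w x. ip w (tensor x (f w)) = s w *\<^sub>R ip1 (e w) x"
    and left: "\<And>w y. ip w (tensor (e w) y) = s w *\<^sub>R ip2 (f w) y"
    using ex_leading_singular_triple by metis
  define step where "step = (\<lambda>w. w - s w *\<^sub>R tensor (e w) (f w))"
  define V where "V k = (step ^^ k) v" for k
  define \<sigma> where "\<sigma> k = s (V k)" for k
  define e' where "e' k = e (V k)" for k
  define f' where "f' k = f (V k)" for k
  define E where "E k = tensor (e' k) (f' k)" for k
  have V_Suc: "V (Suc k) = V k - \<sigma> k *\<^sub>R E k" for k
    by (simp add: V_def step_def \<sigma>_def E_def e'_def f'_def)
  have V_0: "V 0 = v" by (simp add: V_def)
  have \<sigma>0: "0 \<le> \<sigma> k" for k by (simp add: \<sigma>_def s0)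
  have one: "ip1 (e' k) (e' k) = 1 \<and> ip2 (f' k) (f' k) = 1" if "0 < \<sigma> k" for k
    using nrm[of "V k"] that by (simp add: \<sigma>_def e'_def f'_def H1.ip_self H2.ip_self)
  have right': "ip (V k) (tensor x (f' k)) = \<sigma> k *\<^sub>R ip1 (e' k) x" for k x
    by (simp add: right \<sigma>_def e'_def f'_def)
  have left': "ip (V k) (tensor (e' k) y) = \<sigma> k *\<^sub>R ip2 (f' k) y" for k y
    by (simp add: left \<sigma>_def e'_def f'_def)
  have ip_V_Suc: "ip (V (Suc k)) (tensor x y) = ip (V k) (tensor x y) - \<sigma> k *\<^sub>R (ip1 (e' k) x * ip2 (f' k) y)"
    for k x y by (simp add: V_Suc H.ip.diff_left H.ip_scaleR E_def ip_tensor)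
  \<comment> \<open>Stronger than orthogonality to the removed \<open>E j\<close>: the residual
    annihilates every elementary tensor with left factor \<open>e' j\<close> or right factor
    \<open>f' j\<close>. This yields orthonormality of each system separately.\<close>
  have annih: "ip (V k) (tensor x (f' j)) = 0 \<and> ip (V k) (tensor (e' j) y) = 0" if "j < k" for j k x y
    using that
  proof (induction k arbitrary: x y)
    case (Suc k)
    show ?case
    proof (cases "j = k")
      case True
      then show ?thesis
        unfolding ip_V_Suc using one[of k] \<sigma>0[of k]
        by (cases "\<sigma> k = 0") (simp_all add: right' left')
    next
      case False
      with Suc have IH: "\<And>x. ip (V k) (tensor x (f' j)) = 0" "\<And>y. ip (V k) (tensor (e' j) y) = 0"
        by auto
      have "\<sigma> k *\<^sub>R ip2 (f' k) (f' j) = 0" "\<sigma> k *\<^sub>R ip1 (e' k) (e' j) = 0"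
        unfolding left'[symmetric] right'[symmetric] by (rule IH)+
      then show ?thesis unfolding ip_V_Suc by (auto simp: IH)
    qed
  qed simp
  have orth_lt: "ip1 (e' k) (e' j) = 0 \<and> ip2 (f' k) (f' j) = 0" if "j < k" "0 < \<sigma> k" for j k
    using annih[OF that(1), of "e' k" "f' k"] that(2) by (simp add: left' right')
  have on1: "orthonormal_on ip1 {k. 0 < \<sigma> k} e'" and on2: "orthonormal_on ip2 {k. 0 < \<sigma> k} f'"
    unfolding orthonormal_on_def using orth_lt one H1.ip_eq_0_commute H2.ip_eq_0_commute
    by (metis (mono_tags, lifting) mem_Collect_eq nat_neq_iff)+
  have onE: "orthonormal_on ip {k. 0 < \<sigma> k} E"
    unfolding E_def using on1 on2 by (rule orthonormal_on_tensor)
  have "\<sigma> (Suc k) \<le> \<sigma> k" for k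
  proof (cases "\<sigma> (Suc k) = 0")
    case False
    then have pos: "0 < \<sigma> (Suc k)" using \<sigma>0[of "Suc k"] by simp
    have "of_real (\<sigma> (Suc k)) = ip (V (Suc k)) (E (Suc k))"
      by (simp add: E_def left' one[OF pos] scaleR_conv_of_real)
    \<comment> \<open>Since \<open>E (Suc k)\<close> is orthogonal to \<open>E k\<close>, both
      residuals pair equally with it, and the maximality of \<open>\<sigma> k\<close> for
      \<open>V k\<close> applies.\<close>
    also have "\<dots> = ip (V k) (E (Suc k))"
      using orth_lt[OF lessI pos] H1.ip_eq_0_commute by (simp add: E_def ip_V_Suc)
    finally have "\<sigma> (Suc k) = norm (ip (V k) (E (Suc k)))"
      using pos by (metis abs_of_pos norm_of_real)
    also have "\<dots> \<le> \<sigma> k"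
      using bound[of "V k" "e' (Suc k)" "f' (Suc k)"] pos nrm[of "V (Suc k)"]
      by (simp add: E_def \<sigma>_def e'_def f'_def)
    finally show ?thesis .
  qed (simp add: \<sigma>0)
  then have dec: "decseq \<sigma>" by (rule decseq_SucI)
  have V_eq: "V k = v - (\<Sum>j<k. \<sigma> j *\<^sub>R E j)" for k
    by (induction k) (simp_all add: V_0 V_Suc)
  have sq: "(norm (V k))\<^sup>2 = (norm v)\<^sup>2 - (\<Sum>j<k. (\<sigma> j)\<^sup>2)" for k
  proof (induction k)
    case (Suc k)
    have "ip (V (Suc k)) (\<sigma> k *\<^sub>R E k) = 0"
      using annih[of k "Suc k" "e' k"] by (simp add: E_def H.ip_scaleR_right)
    from H.pythagoras[OF this] have "(norm (V k))\<^sup>2 = (norm (V (Suc k)))\<^sup>2 + (norm (\<sigma> k *\<^sub>R E k))\<^sup>2"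
      by (simp add: V_Suc)
    also have "(norm (\<sigma> k *\<^sub>R E k))\<^sup>2 = (\<sigma> k)\<^sup>2"
      using H.norm_sum_scaleR_orthonormal[OF _ onE, of "{k}" \<sigma>] \<sigma>0[of k] by auto
    finally show ?case using Suc by simp
  qed (simp add: V_0)
  have "(\<Sum>j<k. (\<sigma> j)\<^sup>2) \<le> (norm v)\<^sup>2" for k
    using sq[of k] by (smt (verit) zero_le_power2)
  then have sm: "summable (\<lambda>k. (\<sigma> k)\<^sup>2)"
    by (intro summableI_nonneg_bounded[of _ "(norm v)\<^sup>2"]) auto
  have "\<sigma> k = 0" if "k \<notin> {k. 0 < \<sigma> k}" for k using that \<sigma>0[of k] by simp
  from H.summable_orthonormal[OF onE this sm]
  obtain w where w: "(\<lambda>k. \<sigma> k *\<^sub>R E k) sums w" unfolding summable_def by blast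
  have "v - w = 0"
  proof (rule eq_0_if_ip_tensor_eq_0)
    fix x y
    have "V \<longlonglongrightarrow> v - w"
      using w unfolding V_eq[abs_def] sums_def by (intro tendsto_diff tendsto_const)
    then have lim: "(\<lambda>k. norm (ip (V k) (tensor x y))) \<longlonglongrightarrow> norm (ip (v - w) (tensor x y))"
      by (intro tendsto_norm H.ip.tendsto tendsto_const)
    \<comment> \<open>On elementary tensors \<open>V k\<close> is controlled by
      \<open>\<sigma> k\<close>, which tends to 0 because its squares are summable. This identifies
      the limit of the series.\<close>
    have "(\<lambda>k. sqrt ((\<sigma> k)\<^sup>2)) \<longlonglongrightarrow> sqrt 0"
      by (intro tendsto_real_sqrt summable_LIMSEQ_zero sm)
    then have "(\<lambda>k. \<sigma> k * (norm x * norm y)) \<longlonglongrightarrow> 0"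
      using \<sigma>0 by (intro tendsto_mult_left_zero) simp
    from LIMSEQ_le[OF lim this] bound[of "V _" x y]
    show "ip (v - w) (tensor x y) = 0" by (auto simp: \<sigma>_def)
  qed
  with w have "is_svd ip1 ip2 tensor v \<sigma> e' f'"
    using dec \<sigma>0 on1 on2 by (simp add: is_svd_def E_def)
  then show ?thesis by blast
qed

end

section \<open>Best approximation by tensors of bounded rank\<close>

context hilbert_tensor_product
begin

section \<open>Identities for one fixed singular value decomposition\<close>

context
  fixes v \<sigma> e f
  assumes svd: "is_svd ip1 ip2 tensor v \<sigma> e f"
begin

lemma svd_nonneg: "0 \<le> \<sigma> k" and svd_decseq: "decseq \<sigma>"
  and svd_orthonormal_left: "orthonormal_on ip1 {k. 0 < \<sigma> k} e"
  and svd_orthonormal_right: "orthonormal_on ip2 {k. 0 < \<sigma> k} f"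
  and svd_sums: "(\<lambda>k. \<sigma> k *\<^sub>R tensor (e k) (f k)) sums v"
  using svd by (auto simp: is_svd_def)

lemma svd_sq_antimono: "j \<le> k \<Longrightarrow> (\<sigma> k)\<^sup>2 \<le> (\<sigma> j)\<^sup>2"
  using svd_nonneg svd_decseq by (simp add: decseqD power_mono)

lemma svd_orthonormal_tensor: "orthonormal_on ip {k. 0 < \<sigma> k} (\<lambda>k. tensor (e k) (f k))"
  using svd_orthonormal_left svd_orthonormal_right by (rule orthonormal_on_tensor)

lemma svd_ip:
  assumes "0 < \<sigma> j"
  shows "ip v (tensor x (f j)) = \<sigma> j *\<^sub>R ip1 (e j) x"
proof (rule sums_unique2)
  show "(\<lambda>k. ip (\<sigma> k *\<^sub>R tensor (e k) (f k)) (tensor x (f j))) sums ip v (tensor x (f j))"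
    by (rule bounded_linear.sums[OF H.ip.bounded_linear_left svd_sums])
  have "ip (\<sigma> k *\<^sub>R tensor (e k) (f k)) (tensor x (f j)) = (if k = j then \<sigma> j *\<^sub>R ip1 (e j) x else 0)" for k
    using assms svd_orthonormal_right svd_nonneg[of k]
    by (cases "\<sigma> k = 0") (auto simp: H.ip_scaleR ip_tensor orthonormal_on_def H.ip.zero_left)
  then show "(\<lambda>k. ip (\<sigma> k *\<^sub>R tensor (e k) (f k)) (tensor x (f j))) sums (\<sigma> j *\<^sub>R ip1 (e j) x)"
    using sums_single[of j "\<lambda>_. \<sigma> j *\<^sub>R ip1 (e j) x"] by simp
qed

text \<open>The upper half of Eckart-Young: Bessel's defect with coefficients
  \<open>\<sigma> k\<close>. Subtracting a finite sum from the squared norm replaces the tail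
  series.\<close>

lemma svd_norm_residual:
  "(norm (v - (\<Sum>k<r. \<sigma> k *\<^sub>R tensor (e k) (f k))))\<^sup>2 = (norm v)\<^sup>2 - (\<Sum>k<r. (\<sigma> k)\<^sup>2)"
proof -
  let ?E = "\<lambda>k. tensor (e k) (f k)" and ?K = "{..<r} \<inter> {k. 0 < \<sigma> k}"
  have on: "orthonormal_on ip ?K ?E"
    using svd_orthonormal_tensor by (auto simp: orthonormal_on_def)
  have coeff: "ip v (?E k) = of_real (\<sigma> k)" if "0 < \<sigma> k" for k
    using svd_ip[OF that, of "e k"] svd_orthonormal_left that
    by (simp add: orthonormal_on_def scaleR_conv_of_real)
  have "\<sigma> k = 0" if "\<not> 0 < \<sigma> k" for k using that svd_nonneg[of k] by simp
  then have "(\<Sum>k<r. \<sigma> k *\<^sub>R ?E k) = (\<Sum>k\<in>?K. \<sigma> k *\<^sub>R ?E k)"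
    "(\<Sum>k<r. (\<sigma> k)\<^sup>2) = (\<Sum>k\<in>?K. (\<sigma> k)\<^sup>2)"
    by (intro sum.mono_neutral_right; auto)+
  then show ?thesis
    using H.norm_bessel_residual[OF _ on, of v] by (simp add: coeff H.scale_of_real)
qed

lemma svd_sums_sq: "(\<lambda>k. (\<sigma> k)\<^sup>2) sums (norm v)\<^sup>2"
proof -
  have "(\<lambda>r. v - (\<Sum>k<r. \<sigma> k *\<^sub>R tensor (e k) (f k))) \<longlonglongrightarrow> v - v"
    using svd_sums unfolding sums_def by (intro tendsto_diff tendsto_const)
  then have "(\<lambda>r. (norm v)\<^sup>2 - (norm (v - (\<Sum>k<r. \<sigma> k *\<^sub>R tensor (e k) (f k))))\<^sup>2)
      \<longlonglongrightarrow> (norm v)\<^sup>2 - (norm (v - v))\<^sup>2"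
    by (rule tendsto_diff[OF tendsto_const tendsto_power[OF tendsto_norm]])
  then show ?thesis by (simp add: svd_norm_residual sums_def)
qed

end

text \<open>A total weight of at most r, at most 1 per index, collects most when placed on the r
  largest values.\<close>

lemma weighted_sum_le_initial_sum:
  fixes s t :: "nat \<Rightarrow> real"
  assumes "\<And>j k. j \<le> k \<Longrightarrow> s k \<le> s j" and s0: "\<And>k. 0 \<le> s k"
    and t: "\<And>k. 0 \<le> t k" "\<And>k. t k \<le> 1" "(\<Sum>k<n. t k) \<le> real r" and "r \<le> n"
  shows "(\<Sum>k<n. s k * t k) \<le> (\<Sum>k<r. s k)"
proof -
  have split: "(\<Sum>k<n. g k) = (\<Sum>k<r. g k) + (\<Sum>k=r..<n. g k)" for g :: "nat \<Rightarrow> real"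
    using sum.atLeastLessThan_concat[of 0 r n g] \<open>r \<le> n\<close> by (simp add: lessThan_atLeast0)
  have "(\<Sum>k<n. s k * t k) - (\<Sum>k<r. s k) = (\<Sum>k<r. s k * (t k - 1)) + (\<Sum>k=r..<n. s k * t k)"
    by (simp add: split algebra_simps sum_subtractf)
  \<comment> \<open>Every value is compared with the pivot \<open>s r\<close>; on the first r
    indices the factor \<open>t k - 1\<close> is nonpositive, so lowering \<open>s k\<close> to the
    pivot raises the sum.\<close>
  also have "\<dots> \<le> (\<Sum>k<r. s r * (t k - 1)) + (\<Sum>k=r..<n. s r * t k)"
    using assms by (intro add_mono sum_mono mult_right_mono mult_right_mono_neg) auto
  also have "\<dots> = s r * ((\<Sum>k<n. t k) - real r)"
    by (simp add: split sum_distrib_left[symmetric] sum_subtractf algebra_simps)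
  also have "\<dots> \<le> 0" using s0 t(3) by (simp add: mult_nonneg_nonpos)
  finally show ?thesis by simp
qed

text \<open>The lower half of the Eckart-Young theorem. With \<open>P\<close> the projection orthogonal to all
  \<open>a i\<close>, the vector \<open>z = \<Sum>k. \<sigma> k *\<^sub>R tensor (P (e k)) (f k)\<close> is orthogonal to the approximant and
  satisfies \<open>ip v z = (norm z)\<^sup>2\<close>, so the error is at least \<open>norm z\<close>; Bessel's inequality bounds
  what \<open>P\<close> removes from the vectors \<open>e k\<close>.\<close>

lemma eckart_young_lower:
  assumes svd: "is_svd ip1 ip2 tensor v \<sigma> e f"
  shows "(norm v)\<^sup>2 - (\<Sum>k<r. (\<sigma> k)\<^sup>2) \<le> (norm (v - (\<Sum>i<r. tensor (a i) (b i))))\<^sup>2"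
proof -
  let ?w = "\<Sum>i<r. tensor (a i) (b i)"
  obtain m g where m: "m \<le> r" and g: "orthonormal_on ip1 {..<m} g"
    and ann: "\<And>x i. (\<forall>i<m. ip1 x (g i) = 0) \<Longrightarrow> i < r \<Longrightarrow> ip1 x (a i) = 0"
    using H1.ex_orthonormal_annihilator[of r a] by metis
  note \<sigma>0 = svd_nonneg[OF svd] and on1 = svd_orthonormal_left[OF svd]
    and on2 = svd_orthonormal_right[OF svd]
  define p where "p k = e k - (\<Sum>i<m. scale1 (ip1 (e k) (g i)) (g i))" for k
  \<comment> \<open>The squared length of what P removes from \<open>e k\<close>. The default 0
    keeps the weights in [0, 1] where \<open>e k\<close> is unconstrained.\<close>
  define t where "t k = (if 0 < \<sigma> k then \<Sum>i<m. (norm (ip1 (e k) (g i)))\<^sup>2 else 0)" for k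
  have pg: "ip1 (p k) (g i) = 0" if "i < m" for i k
    using H1.ip_bessel_residual[OF _ g, of i "e k"] that by (simp add: p_def)
  then have pa: "ip1 (p k) (a i) = 0" if "i < r" for i k
    using ann that by blast
  have np: "(norm (p k))\<^sup>2 = 1 - t k" if "0 < \<sigma> k" for k
    using H1.norm_bessel_residual[OF _ g, of "e k"] H1.orthonormal_on_norm[OF on1, of k] that
    by (simp add: p_def t_def)
  have t1: "t k \<le> 1" for k
  proof (cases "0 < \<sigma> k")
    case True
    from np[OF this] have "0 \<le> 1 - t k" by (metis zero_le_power2)
    then show ?thesis by simp
  qed (simp add: t_def)
  have t0: "0 \<le> t k" for k by (simp add: t_def sum_nonneg)
  have ep: "ip1 (e k) (p k) = of_real (1 - t k)" if "0 < \<sigma> k" for k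
  proof -
    have "ip1 (p k) (p k) = ip1 (e k) (p k) - (\<Sum>i<m. ip1 (e k) (g i) * ip1 (g i) (p k))"
      by (subst p_def) (simp add: H1.ip.diff_left H1.ip.sum_left H1.ip_scale)
    also have "\<dots> = ip1 (e k) (p k)"
      using pg H1.ip_eq_0_commute by (simp add: sum.neutral)
    finally show ?thesis using np[OF that] by (metis H1.ip_self)
  qed
  \<comment> \<open>Truncation at n keeps z a finite sum; the limit in n restores
    \<open>norm v\<close>.\<close>
  have main: "(\<Sum>k<n. (\<sigma> k)\<^sup>2) - (\<Sum>k<r. (\<sigma> k)\<^sup>2) \<le> (norm (v - ?w))\<^sup>2" if "r \<le> n" for n
  proof -
    let ?K = "{k\<in>{..<n}. 0 < \<sigma> k}"
    define z where "z = (\<Sum>k\<in>?K. \<sigma> k *\<^sub>R tensor (p k) (f k))"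
    define d where "d = (\<Sum>k\<in>?K. (\<sigma> k)\<^sup>2 * (1 - t k))"
    have "ip z z = (\<Sum>j\<in>?K. \<Sum>k\<in>?K. (\<sigma> j * \<sigma> k) *\<^sub>R (ip1 (p k) (p j) * ip2 (f k) (f j)))"
      unfolding z_def H.ip.sum_left H.ip.sum_right
      by (intro sum.cong refl) (simp add: H.ip_scaleR H.ip_scaleR_right ip_tensor)
    also have "\<dots> = (\<Sum>j\<in>?K. \<Sum>k\<in>?K. if k = j then of_real ((\<sigma> k)\<^sup>2 * (1 - t k)) else 0)"
      using on2 np by (intro sum.cong refl)
        (auto simp: orthonormal_on_def H1.ip_self scaleR_conv_of_real power2_eq_square
          simp flip: of_real_power)
    also have "\<dots> = of_real d" by (simp add: d_def)
    finally have nz: "(norm z)\<^sup>2 = d" unfolding H.ip_self by (simp only: of_real_eq_iff)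
    have "ip v z = (\<Sum>k\<in>?K. of_real ((\<sigma> k)\<^sup>2 * (1 - t k)))"
      unfolding z_def H.ip.sum_right
      by (intro sum.cong refl)
        (simp add: H.ip_scaleR_right svd_ip[OF svd] ep scaleR_conv_of_real power2_eq_square)
    also have "\<dots> = of_real d" by (simp add: d_def)
    finally have vz: "ip v z = of_real d" .
    have wz: "ip ?w z = 0"
      unfolding z_def H.ip.sum_right H.ip.sum_left
      using pa H1.ip_eq_0_commute
      by (intro sum.neutral ballI) (simp add: H.ip_scaleR_right H.ip.sum_left ip_tensor)
    have "d = norm (ip (v - ?w) z)"
      using nz[symmetric] by (simp add: H.ip.diff_left vz wz norm_power)
    also have "\<dots> \<le> norm (v - ?w) * norm z" by (rule H.cauchy_schwarz)
    finally have "norm z * norm z \<le> norm (v - ?w) * norm z"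
      using nz by (simp add: power2_eq_square)
    then have "norm z \<le> norm (v - ?w)" by (cases "z = 0") auto
    then have "d \<le> (norm (v - ?w))\<^sup>2" unfolding nz[symmetric] by (rule power_mono) simp
    moreover have "d = (\<Sum>k<n. (\<sigma> k)\<^sup>2 * (1 - t k))"
      unfolding d_def using \<sigma>0 by (intro sum.mono_neutral_left) (auto simp: le_less)
    moreover have "(\<Sum>k<n. t k) \<le> real r"
    proof -
      have "(\<Sum>k<n. t k) = (\<Sum>k\<in>?K. \<Sum>i<m. (norm (ip1 (e k) (g i)))\<^sup>2)"
        unfolding t_def by (subst sum.inter_filter) auto
      \<comment> \<open>After the exchange, Bessel's inequality applies to each unit vector
        \<open>g i\<close> against the system e, so the total removed is at most m.\<close>
      also have "\<dots> = (\<Sum>i<m. \<Sum>k\<in>?K. (norm (ip1 (g i) (e k)))\<^sup>2)"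
        by (subst sum.swap, intro sum.cong refl) (metis H1.ip_commute norm_conj)
      also have "\<dots> \<le> (\<Sum>i<m. (norm (g i))\<^sup>2)"
      proof (intro sum_mono H1.bessel)
        show "orthonormal_on ip1 ?K e" using on1 by (simp add: orthonormal_on_def)
      qed simp
      also have "\<dots> = real m" using H1.orthonormal_on_norm[OF g] by simp
      finally show ?thesis using m by simp
    qed
    then have "(\<Sum>k<n. (\<sigma> k)\<^sup>2 * t k) \<le> (\<Sum>k<r. (\<sigma> k)\<^sup>2)"
      using svd_sq_antimono[OF svd] t0 t1 that by (intro weighted_sum_le_initial_sum) auto
    ultimately show ?thesis by (simp add: algebra_simps sum_subtractf)
  qed
  show ?thesis
  proof (rule LIMSEQ_le_const2)
    show "(\<lambda>n. (\<Sum>k<n. (\<sigma> k)\<^sup>2) - (\<Sum>k<r. (\<sigma> k)\<^sup>2)) \<longlonglongrightarrow> (norm v)\<^sup>2 - (\<Sum>k<r. (\<sigma> k)\<^sup>2)"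
      using svd_sums_sq[OF svd] unfolding sums_def by (intro tendsto_diff tendsto_const)
  qed (use main in blast)
qed

text \<open>The truncation of one decomposition competes in the lower bound of the other, and its
  error is known exactly.\<close>

lemma svd_partial_sum_le:
  assumes v: "is_svd ip1 ip2 tensor v \<sigma> e f" and v': "is_svd ip1 ip2 tensor v \<sigma>' e' f'"
  shows "(\<Sum>k<r. (\<sigma>' k)\<^sup>2) \<le> (\<Sum>k<r. (\<sigma> k)\<^sup>2)"
  using eckart_young_lower[OF v, of r "\<lambda>k. \<sigma>' k *\<^sub>R e' k" f'] svd_norm_residual[OF v', of r]
  by (simp add: tensor.scaleR_left)

lemma svd_unique:
  assumes v: "is_svd ip1 ip2 tensor v \<sigma> e f" and v': "is_svd ip1 ip2 tensor v \<sigma>' e' f'"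
  shows "\<sigma>' = \<sigma>"
proof
  fix k
  have "(\<Sum>j<r. (\<sigma>' j)\<^sup>2) = (\<Sum>j<r. (\<sigma> j)\<^sup>2)" for r
    using svd_partial_sum_le[OF v v'] svd_partial_sum_le[OF v' v] by (rule order_antisym)
  from this[of "Suc k"] this[of k] have "(\<sigma>' k)\<^sup>2 = (\<sigma> k)\<^sup>2" by simp
  then show "\<sigma>' k = \<sigma> k"
    using svd_nonneg[OF v] svd_nonneg[OF v'] by (simp add: power2_eq_iff_nonneg)
qed

lemma singular_values_eq:
  assumes "is_svd ip1 ip2 tensor v \<sigma> e f"
  shows "singular_values ip1 ip2 tensor v = \<sigma>"
  unfolding singular_values_def using assms svd_unique by (intro the_equality) blast+

text \<open>The singular values decrease, so the indices with value 0 are upward closed; if there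
  are none, the rank is infinite.\<close>

lemma tensor_rank_le_iff:
  "tensor_rank ip1 ip2 tensor v \<le> enat r \<longleftrightarrow> singular_values ip1 ip2 tensor v r = 0"
proof
  let ?s = "singular_values ip1 ip2 tensor v" and ?A = "{enat r |r. singular_values ip1 ip2 tensor v r = 0}"
  assume le: "tensor_rank ip1 ip2 tensor v \<le> enat r"
  then have "?A \<noteq> {}" unfolding tensor_rank_def by (auto simp: Inf_enat_def split: if_splits)
  then have "Inf ?A \<in> ?A" unfolding Inf_enat_def by (auto intro: LeastI)
  then obtain j where j: "?s j = 0" "j \<le> r"
    using le unfolding tensor_rank_def by auto
  obtain \<sigma> e f where svd: "is_svd ip1 ip2 tensor v \<sigma> e f" using ex_svd by blast
  with j have "\<sigma> j = 0" by (simp add: singular_values_eq)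
  with decseqD[OF svd_decseq[OF svd] j(2)] svd_nonneg[OF svd, of r] have "\<sigma> r = 0" by simp
  then show "?s r = 0" using svd by (simp add: singular_values_eq)
next
  assume "singular_values ip1 ip2 tensor v r = 0"
  then show "tensor_rank ip1 ip2 tensor v \<le> enat r"
    unfolding tensor_rank_def by (intro Inf_lower) blast
qed

text \<open>Cutting off the singular values leaves a decomposition with the same vectors, and
  uniqueness identifies its values.\<close>

lemma tensor_rank_svd_truncation:
  assumes svd: "is_svd ip1 ip2 tensor v \<sigma> e f"
  shows "tensor_rank ip1 ip2 tensor (\<Sum>k<r. \<sigma> k *\<^sub>R tensor (e k) (f k)) \<le> enat r"
proof -
  let ?\<sigma> = "\<lambda>k. if k < r then \<sigma> k else 0"
  have "(\<lambda>k. ?\<sigma> k *\<^sub>R tensor (e k) (f k)) sums (\<Sum>k\<in>{..<r}. ?\<sigma> k *\<^sub>R tensor (e k) (f k))"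
    by (rule sums_finite) auto
  moreover have "decseq ?\<sigma>"
    using svd_decseq[OF svd] svd_nonneg[OF svd] by (auto simp: decseq_def)
  ultimately have "is_svd ip1 ip2 tensor (\<Sum>k<r. \<sigma> k *\<^sub>R tensor (e k) (f k)) ?\<sigma> e f"
    using svd by (auto simp: is_svd_def orthonormal_on_def)
  then show ?thesis by (simp add: tensor_rank_le_iff singular_values_eq)
qed

lemma tensor_rank_le_imp_sum:
  assumes "tensor_rank ip1 ip2 tensor w \<le> enat r"
  shows "\<exists>a b. w = (\<Sum>i<r. tensor (a i) (b i))"
proof -
  obtain \<sigma> e f where svd: "is_svd ip1 ip2 tensor w \<sigma> e f" using ex_svd by blast
  with assms have r: "\<sigma> r = 0" by (simp add: tensor_rank_le_iff singular_values_eq)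
  have "\<sigma> k = 0" if "k \<notin> {..<r}" for k
    using decseqD[OF svd_decseq[OF svd], of r k] svd_nonneg[OF svd, of k] r that by simp
  then have "(\<lambda>k. \<sigma> k *\<^sub>R tensor (e k) (f k)) sums (\<Sum>k<r. \<sigma> k *\<^sub>R tensor (e k) (f k))"
    by (intro sums_finite) auto
  then have "w = (\<Sum>k<r. tensor (\<sigma> k *\<^sub>R e k) (f k))"
    using svd_sums[OF svd] by (simp add: sums_unique2 tensor.scaleR_left)
  then show ?thesis by (intro exI[of _ "\<lambda>k. \<sigma> k *\<^sub>R e k"] exI[of _ f])
qed

lemma eckart_young_rank:
  assumes "is_svd ip1 ip2 tensor v \<sigma> e f" "tensor_rank ip1 ip2 tensor w \<le> enat r"
  shows "sqrt ((norm v)\<^sup>2 - (\<Sum>k<r. (\<sigma> k)\<^sup>2)) \<le> norm (v - w)"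
proof -
  obtain a b where "w = (\<Sum>i<r. tensor (a i) (b i))"
    using tensor_rank_le_imp_sum[OF assms(2)] by blast
  with eckart_young_lower[OF assms(1)] show ?thesis by (auto intro: real_le_lsqrt)
qed

lemma best_approx_error_eq:
  assumes svd: "is_svd ip1 ip2 tensor v \<sigma> e f"
  shows "best_approx_error ip1 ip2 tensor r v = sqrt ((norm v)\<^sup>2 - (\<Sum>k<r. (\<sigma> k)\<^sup>2))"
  unfolding best_approx_error_def
proof (rule cInf_eq_minimum)
  let ?w = "\<Sum>k<r. \<sigma> k *\<^sub>R tensor (e k) (f k)"
  have "sqrt ((norm v)\<^sup>2 - (\<Sum>k<r. (\<sigma> k)\<^sup>2)) = norm (v - ?w)"
    by (simp flip: svd_norm_residual[OF svd])
  then show "sqrt ((norm v)\<^sup>2 - (\<Sum>k<r. (\<sigma> k)\<^sup>2))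
      \<in> {norm (v - w) |w. tensor_rank ip1 ip2 tensor w \<le> enat r}"
    using tensor_rank_svd_truncation[OF svd, of r] by blast
qed (use eckart_young_rank[OF svd] in auto)

lemma best_approx_error_le:
  assumes "tensor_rank ip1 ip2 tensor w \<le> enat r"
  shows "best_approx_error ip1 ip2 tensor r v \<le> norm (v - w)"
  using ex_svd[of v] best_approx_error_eq eckart_young_rank[OF _ assms] by metis

lemma best_approx_error_nonneg: "0 \<le> best_approx_error ip1 ip2 tensor r v"
proof -
  obtain \<sigma> e f where svd: "is_svd ip1 ip2 tensor v \<sigma> e f" using ex_svd by blast
  show ?thesis
    unfolding best_approx_error_eq[OF svd] svd_norm_residual[OF svd, symmetric] by simp
qed

text \<open>The squared error is a convex function of the rank. The reals \<open>x\<close> and \<open>y\<close> stand for the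
  possibly non-integral powers of \<open>R\<close> around \<open>r\<close>.\<close>

lemma best_approx_error_interpolation:
  fixes x y A B :: real
  assumes a: "(best_approx_error ip1 ip2 tensor a v)\<^sup>2 \<le> A" "real a \<le> x" "x \<le> real r"
    and b: "(best_approx_error ip1 ip2 tensor b v)\<^sup>2 \<le> B" "real b \<le> y" "r \<le> b" "real r < y"
  shows "(y - x) * (best_approx_error ip1 ip2 tensor r v)\<^sup>2 \<le> (y - real r) * A + (real r - x) * B"
proof -
  obtain \<sigma> e f where svd: "is_svd ip1 ip2 tensor v \<sigma> e f" using ex_svd by blast
  have sq: "(best_approx_error ip1 ip2 tensor n v)\<^sup>2 = (norm v)\<^sup>2 - (\<Sum>k<n. (\<sigma> k)\<^sup>2)" for n
    unfolding best_approx_error_eq[OF svd] svd_norm_residual[OF svd, symmetric] by simp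
  have split: "(\<Sum>k<n. (\<sigma> k)\<^sup>2) = (\<Sum>k<m. (\<sigma> k)\<^sup>2) + (\<Sum>k=m..<n. (\<sigma> k)\<^sup>2)" if "m \<le> n" for m n
    using sum.atLeastLessThan_concat[of 0 m n "\<lambda>k. (\<sigma> k)\<^sup>2"] that by (simp add: lessThan_atLeast0)
  \<comment> \<open>\<open>?s\<close> is the common slope behind the convexity: the squares before
    index r are at least \<open>?s\<close>, those from r on at most \<open>?s\<close>.\<close>
  let ?g = "(best_approx_error ip1 ip2 tensor r v)\<^sup>2" and ?s = "(\<sigma> r)\<^sup>2"
  have ar: "a \<le> r" using a by linarith
  have "real (r - a) * ?s \<le> (\<Sum>k=a..<r. (\<sigma> k)\<^sup>2)"
    using sum_bounded_below[of "{a..<r}" ?s "\<lambda>k. (\<sigma> k)\<^sup>2"] svd_sq_antimono[OF svd] by simp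
  \<comment> \<open>Passing from the integer a to the larger real x only weakens the slope
    term.\<close>
  moreover have "(x - real a) * ?s \<ge> 0" using a by simp
  ultimately have 1: "?g \<le> A - (real r - x) * ?s"
    using a(1) ar unfolding sq split[OF ar] by (simp add: of_nat_diff algebra_simps)
  have "(\<Sum>k=r..<b. (\<sigma> k)\<^sup>2) \<le> real (b - r) * ?s"
    using sum_bounded_above[of "{r..<b}" "\<lambda>k. (\<sigma> k)\<^sup>2" ?s] svd_sq_antimono[OF svd] by simp
  moreover have "(y - real b) * ?s \<ge> 0" using b by simp
  ultimately have 2: "?g \<le> B + (y - real r) * ?s"
    using b(1) b(3) unfolding sq split[OF b(3)] by (simp add: of_nat_diff algebra_simps)
  \<comment> \<open>The weights add up to y - x and make the slope terms cancel.\<close>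
  have "(y - real r) * ?g + (real r - x) * ?g
      \<le> (y - real r) * (A - (real r - x) * ?s) + (real r - x) * (B + (y - real r) * ?s)"
    using a b 1 2 by (intro add_mono mult_left_mono) auto
  then show ?thesis by (simp add: algebra_simps)
qed

end

section \<open>Decay of the approximation error along an iteration\<close>

context hilbert_tensor_product
begin

text \<open>The element of rank at most one makes the set nonempty; over the empty set an infimum of
  reals would carry no information.\<close>

lemma initial_error_greatest:
  assumes "\<exists>w\<in>D. tensor_rank ip1 ip2 tensor w \<le> 1"
    and "\<And>w. w \<in> D \<Longrightarrow> tensor_rank ip1 ip2 tensor w \<le> 1 \<Longrightarrow> x \<le> norm (w - v)"
  shows "x \<le> initial_error ip1 ip2 tensor D v"
  unfolding initial_error_def using assms by (intro cInf_greatest) auto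

text \<open>The induction runs in \<open>ereal\<close> because a rank may be infinite. The resulting
  bound shows finiteness, and integrality of the rank then allows the floor.\<close>

lemma rank_power_bound:
  assumes "1 < (R::real)" "tensor_rank ip1 ip2 tensor w \<le> 1"
    and step: "\<And>n. ereal_of_enat (tensor_rank ip1 ip2 tensor ((\<Phi> ^^ Suc n) w))
      \<le> ereal R * ereal_of_enat (tensor_rank ip1 ip2 tensor ((\<Phi> ^^ n) w))"
  shows "tensor_rank ip1 ip2 tensor ((\<Phi> ^^ n) w) \<le> enat (nat \<lfloor>R ^ n\<rfloor>)"
proof -
  let ?r = "\<lambda>n. ereal_of_enat (tensor_rank ip1 ip2 tensor ((\<Phi> ^^ n) w))"
  have le: "?r n \<le> ereal (R ^ n)"
  proof (induction n)
    case 0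
    have "?r 0 \<le> ereal_of_enat (enat 1)"
      using assms(2) by (simp only: ereal_of_enat_le_iff funpow_0 one_enat_def)
    then show ?case by simp
  next
    case (Suc n)
    have "?r (Suc n) \<le> ereal R * ?r n" by (rule step)
    also have "\<dots> \<le> ereal R * ereal (R ^ n)"
      using Suc assms(1) by (intro ereal_mult_left_mono) auto
    finally show ?case by simp
  qed
  then obtain m where m: "tensor_rank ip1 ip2 tensor ((\<Phi> ^^ n) w) = enat m"
    by (cases "tensor_rank ip1 ip2 tensor ((\<Phi> ^^ n) w)") auto
  with le have "real m \<le> R ^ n" by simp
  with m show ?thesis by (simp add: le_nat_iff le_floor_iff)
qed

end

theorem theorem1:
  fixes scale1 :: "'k::rc_field \<Rightarrow> 'a::banach \<Rightarrow> 'a" and ip1 :: "'a \<Rightarrow> 'a \<Rightarrow> 'k"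
    and scale2 :: "'k \<Rightarrow> 'b::banach \<Rightarrow> 'b" and ip2 :: "'b \<Rightarrow> 'b \<Rightarrow> 'k"
    and scale :: "'k \<Rightarrow> 'c::banach \<Rightarrow> 'c" and ip :: "'c \<Rightarrow> 'c \<Rightarrow> 'k"
    and tensor :: "'a \<Rightarrow> 'b \<Rightarrow> 'c"
    and u :: 'c and \<Phi> :: "'c \<Rightarrow> 'c" and D :: "'c set" and q c R :: real
  defines "rk \<equiv> tensor_rank ip1 ip2 tensor"
    and "\<tau> \<equiv> \<lambda>r. best_approx_error ip1 ip2 tensor r u"
    and "\<pi>1 \<equiv> initial_error ip1 ip2 tensor D u"
  assumes "hilbert_tensor_product scale1 ip1 scale2 ip2 scale ip tensor"
    and "0 < q" and "q < 1" and "0 < c" and "1 < R"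
    and "\<And>u0 n. u0 \<in> D \<Longrightarrow>
           norm ((\<Phi> ^^ Suc n) u0 - u) \<le> c * q ^ Suc n * norm (u0 - u)"
    and "\<And>u0 n. u0 \<in> D \<Longrightarrow>
           ereal_of_enat (rk ((\<Phi> ^^ Suc n) u0)) \<le> ereal R * ereal_of_enat (rk ((\<Phi> ^^ n) u0))"
    and "\<exists>v\<in>D. rk v \<le> 1"
  shows "\<forall>r::nat. 1 \<le> r \<longrightarrow>
     (1 \<le> c \<or> \<lfloor>R\<rfloor> \<le> int r \<longrightarrow>
        \<tau> r \<le> c * \<pi>1
              * sqrt (1 - (1 - q\<^sup>2) * (real r - R powi \<lfloor>log R (real r)\<rfloor>)
                          / ((R - 1) * R powi \<lfloor>log R (real r)\<rfloor>))
              * q powi \<lfloor>log R (real r)\<rfloor> \<and>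
        \<tau> r \<le> c * \<pi>1 * q powi \<lfloor>log R (real r)\<rfloor>) \<and>
     c * \<pi>1 * q powi \<lfloor>log R (real r)\<rfloor> \<le> c * \<pi>1 * q powr (log R (real r) - 1) \<and>
     c * \<pi>1 * q powr (log R (real r) - 1)
       = c * \<pi>1 * inverse q * (1 / real r) powr \<bar>ln q / ln R\<bar>"
proof (intro allI impI, goal_cases)
  case (1 r)
  note r1 = \<open>1 \<le> r\<close>
  interpret hilbert_tensor_product scale1 ip1 scale2 ip2 scale ip tensor by fact
  note q0 = \<open>0 < q\<close> and q1 = \<open>q < 1\<close> and c0 = \<open>0 < c\<close> and R1 = \<open>1 < R\<close>
    and iter = assms(9) and rank_growth = assms(10)[unfolded rk_def]
    and start = assms(11)[unfolded rk_def]
  define L where "L = log R (real r)"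
  define N where "N = nat \<lfloor>L\<rfloor>"
  have L0: "0 \<le> L" using R1 r1 by (simp add: L_def)
  \<comment> \<open>As r \<ge> 1, the logarithm is nonnegative and the integer exponents become
    natural ones.\<close>
  then have LN: "\<lfloor>log R (real r)\<rfloor> = int N" by (simp add: N_def L_def)
  have RN: "0 < R ^ N" using R1 by simp
  have "real N \<le> L" "L < real (Suc N)" using L0 by (simp_all add: N_def) linarith+
  then have lower: "R ^ N \<le> real r" and upper: "real r < R ^ Suc N"
    using R1 r1 unfolding L_def
    by (simp_all add: le_log_iff log_less_iff powr_realpow flip: of_nat_Suc del: power_Suc)
  have pi0: "0 \<le> \<pi>1" unfolding \<pi>1_def using start by (rule initial_error_greatest) simp
  have \<tau>0: "0 \<le> \<tau> n" for n by (simp add: \<tau>_def best_approx_error_nonneg)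
  have \<tau>_iter: "\<tau> (nat \<lfloor>R ^ n\<rfloor>) \<le> c * q ^ n * \<pi>1" if n: "0 < n \<or> 1 \<le> c" for n
  proof -
    \<comment> \<open>Division by the positive factor turns the estimate into a lower bound for
      every competitor, hence for the infimum, which need not be attained.\<close>
    have "\<tau> (nat \<lfloor>R ^ n\<rfloor>) / (c * q ^ n) \<le> \<pi>1"
      unfolding \<pi>1_def using start
    proof (rule initial_error_greatest)
      fix w assume w: "w \<in> D" "tensor_rank ip1 ip2 tensor w \<le> 1"
      have "\<tau> (nat \<lfloor>R ^ n\<rfloor>) \<le> norm (u - (\<Phi> ^^ n) w)"
        unfolding \<tau>_def using rank_power_bound[OF R1 w(2) rank_growth[OF w(1)]]
        by (rule best_approx_error_le)
      also have "\<dots> = norm ((\<Phi> ^^ n) w - u)" by (rule norm_minus_commute)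
      also have "\<dots> \<le> c * q ^ n * norm (w - u)"
      proof (cases n)
        case 0
        with n show ?thesis using mult_right_mono[of 1 c "norm (w - u)"] by simp
      next
        case (Suc m)
        then show ?thesis using iter[OF w(1), of m] by simp
      qed
      finally show "\<tau> (nat \<lfloor>R ^ n\<rfloor>) / (c * q ^ n) \<le> norm (w - u)"
        using c0 q0 by (simp add: divide_le_eq mult_ac)
    qed
    then show ?thesis using c0 q0 by (simp add: divide_le_eq mult_ac)
  qed
  \<comment> \<open>\<theta> is the relative position of r: r = (1 - \<theta>) R^N + \<theta>
    R^(N+1). The squared error bounds at the two ends have ratio q^2, so the interpolated factor is
    F = (1 - \<theta>) + \<theta> q^2.\<close>
  define \<theta> where "\<theta> = (real r - R ^ N) / ((R - 1) * R ^ N)"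
  have den: "0 < (R - 1) * R ^ N" using R1 by simp
  have \<theta>: "0 \<le> \<theta>" "\<theta> \<le> 1"
    using lower upper den by (simp_all add: \<theta>_def divide_le_eq algebra_simps)
  define F where "F = 1 - (1 - q\<^sup>2) * \<theta>"
  have qq: "0 \<le> 1 - q\<^sup>2" using q0 q1 by (simp add: power_le_one)
  have F: "q\<^sup>2 \<le> F" "F \<le> 1"
    using mult_left_le[OF \<theta>(2) qq] mult_nonneg_nonneg[OF qq \<theta>(1)] by (simp_all add: F_def)
  then have F0: "0 \<le> F" by (smt (verit) zero_le_power2)
  have sharp: "\<tau> r \<le> c * \<pi>1 * sqrt F * q ^ N" if cr: "1 \<le> c \<or> \<lfloor>R\<rfloor> \<le> int r"
  proof (cases "0 < N \<or> 1 \<le> c")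
    case True
    let ?C = "(c * \<pi>1)\<^sup>2"
    have sq: "(\<tau> (nat \<lfloor>R ^ n\<rfloor>))\<^sup>2 \<le> ?C * (q ^ n)\<^sup>2" if "0 < n \<or> 1 \<le> c" for n
      using power_mono[OF \<tau>_iter[OF that] \<tau>0, of 2] by (simp add: power_mult_distrib mult_ac)
    have fl: "real (nat \<lfloor>R ^ n\<rfloor>) \<le> R ^ n" for n using R1 by simp
    have "((R - 1) * R ^ N) * (\<tau> r)\<^sup>2 = (R ^ Suc N - R ^ N) * (\<tau> r)\<^sup>2"
      by (simp add: algebra_simps)
    also have "\<dots>
      \<le> (R ^ Suc N - real r) * (?C * (q ^ N)\<^sup>2) + (real r - R ^ N) * (?C * (q ^ Suc N)\<^sup>2)"
      unfolding \<tau>_def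
    proof (rule best_approx_error_interpolation)
      show "(best_approx_error ip1 ip2 tensor (nat \<lfloor>R ^ N\<rfloor>) u)\<^sup>2 \<le> ?C * (q ^ N)\<^sup>2"
        "(best_approx_error ip1 ip2 tensor (nat \<lfloor>R ^ Suc N\<rfloor>) u)\<^sup>2 \<le> ?C * (q ^ Suc N)\<^sup>2"
        using sq[OF True] sq[of "Suc N"] by (simp_all add: \<tau>_def)
      show "r \<le> nat \<lfloor>R ^ Suc N\<rfloor>" using upper by (simp add: le_nat_iff le_floor_iff)
    qed (use fl lower upper in simp_all)
    also have "\<dots> = ((R - 1) * R ^ N) * (?C * (q ^ N)\<^sup>2 * F)"
    proof -
      have 1: "real r - R ^ N = \<theta> * ((R - 1) * R ^ N)" using den R1 by (simp add: \<theta>_def)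
      then have 2: "R ^ Suc N - real r = (1 - \<theta>) * ((R - 1) * R ^ N)"
        by (simp add: algebra_simps)
      show ?thesis
        unfolding 1 2 by (simp add: F_def algebra_simps power2_eq_square)
    qed
    finally have "(\<tau> r)\<^sup>2 \<le> ?C * (q ^ N)\<^sup>2 * F"
      by (simp only: mult_le_cancel_left_pos[OF den])
    also have "\<dots> = (c * \<pi>1 * sqrt F * q ^ N)\<^sup>2"
      using F0 by (simp add: power_mult_distrib mult_ac)
    finally show ?thesis
      by (rule power2_le_imp_le) (use c0 pi0 F0 q0 in simp)
  next
    case False
    then have "N = 0" "c < 1" by auto
    with cr upper have "nat \<lfloor>R ^ 1\<rfloor> = r" by (simp add: floor_eq_iff) linarith
    with \<tau>_iter[of 1] have "\<tau> r \<le> (c * \<pi>1) * q" by (simp add: mult_ac)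
    \<comment> \<open>F is a convex combination of 1 and q^2, so q \<le> sqrt F and the one-step
      bound is at least as strong.\<close>
    also have "\<dots> \<le> (c * \<pi>1) * sqrt F"
      using c0 pi0 F(1) by (intro mult_left_mono real_le_rsqrt) auto
    finally show ?thesis using \<open>N = 0\<close> by simp
  qed
  have crude: "c * \<pi>1 * sqrt F * q ^ N \<le> c * \<pi>1 * q ^ N"
    using c0 pi0 q0 F(2) F0 by (intro mult_right_mono mult_left_le) auto
  have "q ^ N = q powr real N" using q0 by (simp add: powr_realpow)
  also have "\<dots> \<le> q powr (L - 1)"
    using q0 q1 \<open>L < real (Suc N)\<close> by (intro powr_mono') auto
  finally have simplified: "c * \<pi>1 * q ^ N \<le> c * \<pi>1 * q powr (L - 1)"
    using c0 pi0 by (intro mult_left_mono) auto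
  have "q powr L = (1 / real r) powr \<bar>ln q / ln R\<bar>"
  proof -
    have "\<bar>ln q / ln R\<bar> = - (ln q / ln R)"
      using q0 q1 R1 by (intro abs_of_nonpos) (simp add: divide_le_0_iff)
    then show ?thesis using q0 r1 by (simp add: L_def log_def powr_def ln_div)
  qed
  moreover have "q powr (L - 1) = inverse q * q powr L"
    using q0 by (simp add: powr_diff divide_inverse mult.commute)
  ultimately have "c * \<pi>1 * q powr (L - 1) = c * \<pi>1 * inverse q * (1 / real r) powr \<bar>ln q / ln R\<bar>"
    by simp
  with sharp crude simplified show ?case
    unfolding LN power_int_of_nat
    unfolding L_def[symmetric] times_divide_eq_right[symmetric] \<theta>_def[symmetric] F_def[symmetric]
    by (meson order_trans)
qed

end
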